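(* Let $\mathcal V$ be a right closed monoidal bicategory (with underlying monoidal bicategory a Gray monoid). Consider the following data: the objects of $\mathcal V$; hom-objects $\mathcal V(a,b):=[a,b]$; multiplication $$m\colon[b,c][a,b]\xrightarrow{\ \eta\ }[a,[b,c][a,b]a]\xrightarrow{[1,1\varepsilon]}[a,[b,c]b]\xrightarrow{[1,\varepsilon]}[a,c];$$ units $u\colon\mathbb 1\xrightarrow{\eta}[a,\mathbb 1a]=[a,a]$; and the associator $\alpha\colon m(m1)\Rightarrow m(1m)$ and unitors $\lambda\colon m(u1)\Rightarrow1$, $\rho\colon m(1u)\Rightarrow1$ described in the context. These data equip $\mathcal V$ with the structure of a $\mathcal V$-bicategory.
   Context: **Gray monoids.** A Gray monoid is a monoid in the category of 2-categories and 2-functors with the Gray tensor product. So its tensor product is strictly associative and unital (unit $\mathbb 1$), and for 1-cells $f\colon A\to A'$, $g\colon B\to B'$ there is an invertible interchanger $\Sigma_{f,g}\colon (f\otimes B')(A\otimes g)\Rightarrow (A'\otimes g)(f\otimes B)$ satisfying the usual axioms. Juxtaposition denotes tensor product of objects and cells (interchangers being inserted where needed); $1$ denotes an identity. Coherence cells of pseudofunctors are suppressed. **Right closed.** $\mathcal V$ is right closed if for every object $A$ a pseudofunctor $[A,-]\colon\mathcal V\to\mathcal V$ is given together with a pseudoadjunction $-\otimes A\dashv[A,-]$, that is: pseudonatural transformations $\eta_B\colon B\to[A,BA]$ and $\varepsilon_B\colon[A,B]A\to B$, and invertible modifications (triangulators) $s\colon 1_{BA}\Rightarrow\varepsilon_{BA}(\eta_B1)$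 and $t\colon[1,\varepsilon_B]\eta_{[A,B]}\Rightarrow1_{[A,B]}$ satisfying the swallowtail equations: the composites $$\eta\xRightarrow{[1,s]}[1,\varepsilon][1,\eta1]\,\eta\cong[1,\varepsilon]\,\eta\,\eta\xRightarrow{t}\eta,\qquad \varepsilon\xRightarrow{s}\varepsilon\,\varepsilon\,(\eta1)\cong\varepsilon\,([1,\varepsilon]1)(\eta1)\xRightarrow{t1}\varepsilon$$ are identities, where the isomorphisms are the pseudonaturality cells $\eta_\eta$ and $\varepsilon_\varepsilon$. **$\mathcal V$-bicategories.** A $\mathcal V$-bicategory $\mathcal C$ over a Gray monoid $\mathcal V$ consists of a class of objects; hom-objects $\mathcal C(c,d)\in\mathcal V$; 1-cells $m\colon\mathcal C(d,e)\otimes\mathcal C(c,d)\to\mathcal C(c,e)$ and $u_c\colon\mathbb 1\to\mathcal C(c,c)$; and invertible 2-cells $\alpha\colon m(m1)\Rightarrow m(1m)$, $\lambda\colon m(u1)\Rightarrow 1$, $\rho\colon m(1u)\Rightarrow1$, such that - (IC) the composite $m(m1)(1u1)\xRightarrow{\alpha}m(1m)(1u1)\xRightarrow{1\lambda}m$ equals $\rho1\colon m(m1)(1u1)\Rightarrow m$; - (AC) the composite $m(m1)(m11)\xRightarrow{\alpha1}m(m1)(1m1)\xRightarrow{\alpha}m(1m)(1m1)\xRightarrow{1\alpha}m(1m)(11m)$ equals $m(m1)(m11)\xRightarrow{\alpha}m(1m)(m11)\cong m(m1)(11m)\xRightarrow{\alpha}m(1m)(11m)$, the middle isomorphism being the interchanger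 $\Sigma_{m,m}^{-1}$. **Structural 2-cells.** Let $e\colon\varepsilon(m1)\Rightarrow\varepsilon(1\varepsilon)$ (1-cells $[b,c][a,b]a\to c$) be the invertible 2-cell $$\varepsilon([1,\varepsilon]1)([1,1\varepsilon]1)(\eta1)\cong\varepsilon(1\varepsilon)\,\varepsilon\,(\eta1)\xRightarrow{s^{-1}}\varepsilon(1\varepsilon),$$ the isomorphism being pseudonaturality of $\varepsilon$. Then: - $\alpha$ (on $[c,d][b,c][a,b]$) is the composite $$m(m1)=[1,\varepsilon][1,1\varepsilon]\,\eta\,(m1)\cong[1,\varepsilon][1,m1][1,11\varepsilon]\,\eta\xRightarrow{[1,e]}[1,\varepsilon][1,1\varepsilon][1,11\varepsilon]\,\eta\xRightarrow{[1,1e^{-1}]}[1,\varepsilon][1,1\varepsilon][1,1m1]\,\eta\cong[1,\varepsilon][1,1\varepsilon]\,\eta\,(1m)=m(1m),$$ with isomorphisms given by pseudonaturality of $\eta$ and interchangers; - $\lambda$ is $m(u1)=[1,\varepsilon][1,1\varepsilon]\,\eta\,(u1)\cong[1,\varepsilon][1,\eta1][1,\varepsilon]\,\eta\xRightarrow{[1,s^{-1}]}[1,\varepsilon]\,\eta\xRightarrow{t}1$; - $\rho$ is $m(1u)=[1,\varepsilon][1,1\varepsilon]\,\eta\,(1u)\cong[1,\varepsilon][1,1\varepsilon][1,1\eta1]\,\eta\xRightarrow{[1,1s^{-1}]}[1,\varepsilon]\,\eta\xRightarrow{t}1$, with isomorphisms again given by pseudonaturality of $\eta$ and interchangers. *)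

theory Defs
  imports Main
begin

section \<open>Strict 2-categories\<close>

text \<open>
  The objects, 1-cells and 2-cells of a 2-category are the elements of the three types
  \<open>'o\<close>, \<open>'a\<close>, \<open>'t\<close>.  The operations are total functions; nothing is assumed about them
  on arguments that do not match.  Both compositions are written in applicative order:
  \<open>g \<cdot> f\<close> is \<open>f\<close> followed by \<open>g\<close>, and likewise for \<open>\<beta> \<bullet> \<alpha>\<close> (vertical) and
  \<open>\<beta> \<star> \<alpha>\<close> (horizontal).
\<close>

record ('o, 'a, 't) two_cat =
  dom1 :: "'a \<Rightarrow> 'o"
  cod1 :: "'a \<Rightarrow> 'o"
  id1 :: "'o \<Rightarrow> 'a"  ("\<one>\<index>")
  comp1 :: "'a \<Rightarrow> 'a \<Rightarrow> 'a"  (infixr "\<cdot>\<index>" 75)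
  dom2 :: "'t \<Rightarrow> 'a"
  cod2 :: "'t \<Rightarrow> 'a"
  id2 :: "'a \<Rightarrow> 't"  ("\<i>\<index>")
  vcomp :: "'t \<Rightarrow> 't \<Rightarrow> 't"  (infixr "\<bullet>\<index>" 55)
  hcomp :: "'t \<Rightarrow> 't \<Rightarrow> 't"  (infixr "\<star>\<index>" 65)

definition hom1 :: "('o, 'a, 't, 'z) two_cat_scheme \<Rightarrow> 'o \<Rightarrow> 'o \<Rightarrow> 'a set" where
  "hom1 V A B = {f. dom1 V f = A \<and> cod1 V f = B}"

definition hom2 :: "('o, 'a, 't, 'z) two_cat_scheme \<Rightarrow> 'a \<Rightarrow> 'a \<Rightarrow> 't set" where
  "hom2 V f g = {\<theta>. dom2 V \<theta> = f \<and> cod2 V \<theta> = g}"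

context
  fixes V :: "('o, 'a, 't, 'z) two_cat_scheme" (structure)
begin

definition whisker_left :: "'a \<Rightarrow> 't \<Rightarrow> 't" where
  "whisker_left g \<theta> = \<i> g \<star> \<theta>"

definition whisker_right :: "'t \<Rightarrow> 'a \<Rightarrow> 't" where
  "whisker_right \<theta> f = \<theta> \<star> \<i> f"

definition is_inv2 :: "'t \<Rightarrow> 't \<Rightarrow> bool" where
  "is_inv2 \<theta> \<phi> \<longleftrightarrow> dom2 V \<phi> = cod2 V \<theta> \<and> cod2 V \<phi> = dom2 V \<theta> \<and>
     \<phi> \<bullet> \<theta> = \<i> (dom2 V \<theta>) \<and> \<theta> \<bullet> \<phi> = \<i> (cod2 V \<theta>)"

definition invertible2 :: "'t \<Rightarrow> bool" where
  "invertible2 \<theta> \<longleftrightarrow> (\<exists>\<phi>. is_inv2 \<theta> \<phi>)"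

definition inv2 :: "'t \<Rightarrow> 't" where
  "inv2 \<theta> = (THE \<phi>. is_inv2 \<theta> \<phi>)"

definition iso2 :: "'a \<Rightarrow> 'a \<Rightarrow> 't set" where
  "iso2 f g = {\<theta> \<in> hom2 V f g. invertible2 \<theta>}"

end

notation whisker_left  (infixr "\<rhd>\<index>" 65)
notation whisker_right  (infixl "\<lhd>\<index>" 66)

locale two_category =
  fixes V :: "('o, 'a, 't, 'z) two_cat_scheme" (structure)
  assumes id1_hom: "\<one> A \<in> hom1 V A A"
    and comp1_hom: "\<lbrakk>f \<in> hom1 V A B; g \<in> hom1 V B C\<rbrakk> \<Longrightarrow> g \<cdot> f \<in> hom1 V A C"
    and comp1_id_right: "f \<in> hom1 V A B \<Longrightarrow> f \<cdot> \<one> A = f"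
    and comp1_id_left: "f \<in> hom1 V A B \<Longrightarrow> \<one> B \<cdot> f = f"
    and comp1_assoc: "\<lbrakk>f \<in> hom1 V A B; g \<in> hom1 V B C; h \<in> hom1 V C D\<rbrakk>
          \<Longrightarrow> (h \<cdot> g) \<cdot> f = h \<cdot> (g \<cdot> f)"
    and globular_dom: "dom1 V (dom2 V \<theta>) = dom1 V (cod2 V \<theta>)"
    and globular_cod: "cod1 V (dom2 V \<theta>) = cod1 V (cod2 V \<theta>)"
    and id2_hom: "\<i> f \<in> hom2 V f f"
    and vcomp_hom: "\<lbrakk>\<theta> \<in> hom2 V f g; \<phi> \<in> hom2 V g h\<rbrakk> \<Longrightarrow> \<phi> \<bullet> \<theta> \<in> hom2 V f h"
    and vcomp_id_right: "\<theta> \<in> hom2 V f g \<Longrightarrow> \<theta> \<bullet> \<i> f = \<theta>"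
    and vcomp_id_left: "\<theta> \<in> hom2 V f g \<Longrightarrow> \<i> g \<bullet> \<theta> = \<theta>"
    and vcomp_assoc: "\<lbrakk>\<theta> \<in> hom2 V f g; \<phi> \<in> hom2 V g h; \<psi> \<in> hom2 V h k\<rbrakk>
          \<Longrightarrow> (\<psi> \<bullet> \<phi>) \<bullet> \<theta> = \<psi> \<bullet> (\<phi> \<bullet> \<theta>)"
    and hcomp_hom: "\<lbrakk>f \<in> hom1 V A B; g \<in> hom1 V B C; \<theta> \<in> hom2 V f f'; \<phi> \<in> hom2 V g g'\<rbrakk>
          \<Longrightarrow> \<phi> \<star> \<theta> \<in> hom2 V (g \<cdot> f) (g' \<cdot> f')"
    and hcomp_id_right: "\<lbrakk>f \<in> hom1 V A B; \<theta> \<in> hom2 V f f'\<rbrakk> \<Longrightarrow> \<theta> \<star> \<i> (\<one> A) = \<theta>"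
    and hcomp_id_left: "\<lbrakk>f \<in> hom1 V A B; \<theta> \<in> hom2 V f f'\<rbrakk> \<Longrightarrow> \<i> (\<one> B) \<star> \<theta> = \<theta>"
    and hcomp_assoc: "\<lbrakk>f \<in> hom1 V A B; g \<in> hom1 V B C; h \<in> hom1 V C D;
          \<theta> \<in> hom2 V f f'; \<phi> \<in> hom2 V g g'; \<psi> \<in> hom2 V h h'\<rbrakk>
          \<Longrightarrow> (\<psi> \<star> \<phi>) \<star> \<theta> = \<psi> \<star> (\<phi> \<star> \<theta>)"
    and hcomp_id2: "\<lbrakk>f \<in> hom1 V A B; g \<in> hom1 V B C\<rbrakk> \<Longrightarrow> \<i> g \<star> \<i> f = \<i> (g \<cdot> f)"
    and interchange: "\<lbrakk>f \<in> hom1 V A B; g \<in> hom1 V B C;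
          \<theta> \<in> hom2 V f f'; \<theta>' \<in> hom2 V f' f''; \<phi> \<in> hom2 V g g'; \<phi>' \<in> hom2 V g' g''\<rbrakk>
          \<Longrightarrow> (\<phi>' \<bullet> \<phi>) \<star> (\<theta>' \<bullet> \<theta>) = (\<phi>' \<star> \<theta>') \<bullet> (\<phi> \<star> \<theta>)"

locale two_functor = two_category V
  for V :: "('o, 'a, 't, 'z) two_cat_scheme" (structure) +
  fixes F0 :: "'o \<Rightarrow> 'o" and F1 :: "'a \<Rightarrow> 'a" and F2 :: "'t \<Rightarrow> 't"
  assumes F1_hom: "f \<in> hom1 V A B \<Longrightarrow> F1 f \<in> hom1 V (F0 A) (F0 B)"
    and F2_hom: "\<theta> \<in> hom2 V f g \<Longrightarrow> F2 \<theta> \<in> hom2 V (F1 f) (F1 g)"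
    and F1_id: "F1 (\<one> A) = \<one> (F0 A)"
    and F1_comp: "\<lbrakk>f \<in> hom1 V A B; g \<in> hom1 V B C\<rbrakk> \<Longrightarrow> F1 (g \<cdot> f) = F1 g \<cdot> F1 f"
    and F2_id: "F2 (\<i> f) = \<i> (F1 f)"
    and F2_vcomp: "\<lbrakk>\<theta> \<in> hom2 V f g; \<phi> \<in> hom2 V g h\<rbrakk> \<Longrightarrow> F2 (\<phi> \<bullet> \<theta>) = F2 \<phi> \<bullet> F2 \<theta>"
    and F2_hcomp: "\<lbrakk>f \<in> hom1 V A B; g \<in> hom1 V B C; \<theta> \<in> hom2 V f f'; \<phi> \<in> hom2 V g g'\<rbrakk>
          \<Longrightarrow> F2 (\<phi> \<star> \<theta>) = F2 \<phi> \<star> F2 \<theta>"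


section \<open>Pseudofunctors, pseudonatural transformations, modifications\<close>

text \<open>
  Only endo-pseudofunctors of a fixed 2-category are needed.  The coherence cells are
  \<open>pf_comp F g f : F g \<cdot> F f \<Rightarrow> F (g \<cdot> f)\<close> and \<open>pf_unit F A : \<one> (F A) \<Rightarrow> F (\<one> A)\<close>.
\<close>

record ('o, 'a, 't) psfunctor =
  pf0 :: "'o \<Rightarrow> 'o"
  pf1 :: "'a \<Rightarrow> 'a"
  pf2 :: "'t \<Rightarrow> 't"
  pf_comp :: "'a \<Rightarrow> 'a \<Rightarrow> 't"
  pf_unit :: "'o \<Rightarrow> 't"

locale pseudofunctor = two_category V
  for V :: "('o, 'a, 't, 'z) two_cat_scheme" (structure) +
  fixes F :: "('o, 'a, 't) psfunctor"
  assumes pf1_hom: "f \<in> hom1 V A B \<Longrightarrow> pf1 F f \<in> hom1 V (pf0 F A) (pf0 F B)"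
    and pf2_hom: "\<theta> \<in> hom2 V f g \<Longrightarrow> pf2 F \<theta> \<in> hom2 V (pf1 F f) (pf1 F g)"
    and pf2_id: "pf2 F (\<i> f) = \<i> (pf1 F f)"
    and pf2_vcomp: "\<lbrakk>\<theta> \<in> hom2 V f g; \<phi> \<in> hom2 V g h\<rbrakk>
          \<Longrightarrow> pf2 F (\<phi> \<bullet> \<theta>) = pf2 F \<phi> \<bullet> pf2 F \<theta>"
    and pf_comp_iso: "\<lbrakk>f \<in> hom1 V A B; g \<in> hom1 V B C\<rbrakk>
          \<Longrightarrow> pf_comp F g f \<in> iso2 V (pf1 F g \<cdot> pf1 F f) (pf1 F (g \<cdot> f))"
    and pf_unit_iso: "pf_unit F A \<in> iso2 V (\<one> (pf0 F A)) (pf1 F (\<one> A))"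
    and pf_comp_natural: "\<lbrakk>f \<in> hom1 V A B; g \<in> hom1 V B C; \<theta> \<in> hom2 V f f'; \<phi> \<in> hom2 V g g'\<rbrakk>
          \<Longrightarrow> pf_comp F g' f' \<bullet> (pf2 F \<phi> \<star> pf2 F \<theta>) = pf2 F (\<phi> \<star> \<theta>) \<bullet> pf_comp F g f"
    and pf_comp_assoc: "\<lbrakk>f \<in> hom1 V A B; g \<in> hom1 V B C; h \<in> hom1 V C D\<rbrakk>
          \<Longrightarrow> pf_comp F (h \<cdot> g) f \<bullet> (pf_comp F h g \<lhd> pf1 F f)
            = pf_comp F h (g \<cdot> f) \<bullet> (pf1 F h \<rhd> pf_comp F g f)"
    and pf_unit_right: "f \<in> hom1 V A B
          \<Longrightarrow> pf_comp F f (\<one> A) \<bullet> (pf1 F f \<rhd> pf_unit F A) = \<i> (pf1 F f)"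
    and pf_unit_left: "f \<in> hom1 V A B
          \<Longrightarrow> pf_comp F (\<one> B) f \<bullet> (pf_unit F B \<lhd> pf1 F f) = \<i> (pf1 F f)"

text \<open>
  A pseudonatural transformation \<open>\<sigma> : F \<Rightarrow> G\<close> has components \<open>pn1 \<sigma> A : F A \<rightarrow> G A\<close> and
  invertible cells \<open>pn2 \<sigma> f : G f \<cdot> \<sigma> A \<Rightarrow> \<sigma> B \<cdot> F f\<close> for \<open>f : A \<rightarrow> B\<close>.  The locale is
  only used for \<open>F\<close>, \<open>G\<close> that are composites of pseudofunctors.
\<close>

record ('o, 'a, 't) pstrans =
  pn1 :: "'o \<Rightarrow> 'a"
  pn2 :: "'a \<Rightarrow> 't"

locale pseudonatural = two_category V
  for V :: "('o, 'a, 't, 'z) two_cat_scheme" (structure) +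
  fixes F G :: "('o, 'a, 't) psfunctor" and \<sigma> :: "('o, 'a, 't) pstrans"
  assumes pn1_hom: "pn1 \<sigma> A \<in> hom1 V (pf0 F A) (pf0 G A)"
    and pn2_iso: "f \<in> hom1 V A B
          \<Longrightarrow> pn2 \<sigma> f \<in> iso2 V (pf1 G f \<cdot> pn1 \<sigma> A) (pn1 \<sigma> B \<cdot> pf1 F f)"
    and pn2_natural: "\<lbrakk>f \<in> hom1 V A B; \<theta> \<in> hom2 V f g\<rbrakk>
          \<Longrightarrow> pn2 \<sigma> g \<bullet> (pf2 G \<theta> \<lhd> pn1 \<sigma> A) = (pn1 \<sigma> B \<rhd> pf2 F \<theta>) \<bullet> pn2 \<sigma> f"
    and pn2_comp: "\<lbrakk>f \<in> hom1 V A B; g \<in> hom1 V B C\<rbrakk>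
          \<Longrightarrow> pn2 \<sigma> (g \<cdot> f) \<bullet> (pf_comp G g f \<lhd> pn1 \<sigma> A)
            = (pn1 \<sigma> C \<rhd> pf_comp F g f) \<bullet> (pn2 \<sigma> g \<lhd> pf1 F f) \<bullet> (pf1 G g \<rhd> pn2 \<sigma> f)"
    and pn2_unit: "pn2 \<sigma> (\<one> A) \<bullet> (pf_unit G A \<lhd> pn1 \<sigma> A) = pn1 \<sigma> A \<rhd> pf_unit F A"

locale modification = two_category V
  for V :: "('o, 'a, 't, 'z) two_cat_scheme" (structure) +
  fixes F G :: "('o, 'a, 't) psfunctor" and \<sigma> \<tau> :: "('o, 'a, 't) pstrans" and \<Gamma> :: "'o \<Rightarrow> 't"
  assumes mod_hom: "\<Gamma> A \<in> hom2 V (pn1 \<sigma> A) (pn1 \<tau> A)"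
    and mod_natural: "f \<in> hom1 V A B
          \<Longrightarrow> (\<Gamma> B \<lhd> pf1 F f) \<bullet> pn2 \<sigma> f = pn2 \<tau> f \<bullet> (pf1 G f \<rhd> \<Gamma> A)"

context
  fixes V :: "('o, 'a, 't, 'z) two_cat_scheme" (structure)
begin

definition pf_id :: "('o, 'a, 't) psfunctor" where
  "pf_id = \<lparr>pf0 = (\<lambda>A. A), pf1 = (\<lambda>f. f), pf2 = (\<lambda>\<theta>. \<theta>),
     pf_comp = (\<lambda>g f. \<i> (g \<cdot> f)), pf_unit = (\<lambda>A. \<i> (\<one> A))\<rparr>"

definition pf_compose ::
    "('o, 'a, 't) psfunctor \<Rightarrow> ('o, 'a, 't) psfunctor \<Rightarrow> ('o, 'a, 't) psfunctor" where
  "pf_compose G F = \<lparr>pf0 = (\<lambda>A. pf0 G (pf0 F A)), pf1 = (\<lambda>f. pf1 G (pf1 F f)),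
     pf2 = (\<lambda>\<theta>. pf2 G (pf2 F \<theta>)),
     pf_comp = (\<lambda>g f. pf2 G (pf_comp F g f) \<bullet> pf_comp G (pf1 F g) (pf1 F f)),
     pf_unit = (\<lambda>A. pf2 G (pf_unit F A) \<bullet> pf_unit G (pf0 F A))\<rparr>"

text \<open>
  For \<open>\<theta> : g \<cdot> f \<Rightarrow> k \<cdot> h\<close>, the cell \<open>pf_square F g f \<theta> k h\<close> is \<open>F \<theta>\<close> read as a 2-cell
  \<open>F g \<cdot> F f \<Rightarrow> F k \<cdot> F h\<close>.  For \<open>\<theta> : g \<cdot> f \<Rightarrow> \<one> A\<close>, the cell \<open>pf_triangle F g f \<theta> A\<close>
  is \<open>F \<theta>\<close> read as a 2-cell \<open>F g \<cdot> F f \<Rightarrow> \<one> (F A)\<close>; \<open>pf_cotriangle\<close> is the same for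
  \<open>\<theta> : \<one> A \<Rightarrow> g \<cdot> f\<close>.
\<close>

definition pf_square :: "('o, 'a, 't) psfunctor \<Rightarrow> 'a \<Rightarrow> 'a \<Rightarrow> 't \<Rightarrow> 'a \<Rightarrow> 'a \<Rightarrow> 't" where
  "pf_square F g f \<theta> k h = inv2 V (pf_comp F k h) \<bullet> pf2 F \<theta> \<bullet> pf_comp F g f"

definition pf_triangle :: "('o, 'a, 't) psfunctor \<Rightarrow> 'a \<Rightarrow> 'a \<Rightarrow> 't \<Rightarrow> 'o \<Rightarrow> 't" where
  "pf_triangle F g f \<theta> A = inv2 V (pf_unit F A) \<bullet> pf2 F \<theta> \<bullet> pf_comp F g f"

definition pf_cotriangle :: "('o, 'a, 't) psfunctor \<Rightarrow> 'o \<Rightarrow> 't \<Rightarrow> 'a \<Rightarrow> 'a \<Rightarrow> 't" where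
  "pf_cotriangle F A \<theta> g f = inv2 V (pf_comp F g f) \<bullet> pf2 F \<theta> \<bullet> pf_unit F A"

definition pn_id :: "('o, 'a, 't) psfunctor \<Rightarrow> ('o, 'a, 't) pstrans" where
  "pn_id F = \<lparr>pn1 = (\<lambda>A. \<one> (pf0 F A)), pn2 = (\<lambda>f. \<i> (pf1 F f))\<rparr>"

definition pn_compose ::
    "('o, 'a, 't) pstrans \<Rightarrow> ('o, 'a, 't) pstrans \<Rightarrow> ('o, 'a, 't) pstrans" where
  "pn_compose \<tau> \<sigma> = \<lparr>pn1 = (\<lambda>A. pn1 \<tau> A \<cdot> pn1 \<sigma> A),
     pn2 = (\<lambda>f. (pn1 \<tau> (cod1 V f) \<rhd> pn2 \<sigma> f) \<bullet> (pn2 \<tau> f \<lhd> pn1 \<sigma> (dom1 V f)))\<rparr>"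

text \<open>
  The whiskerings \<open>\<sigma> K : F K \<Rightarrow> G K\<close> and \<open>K \<sigma> : K F \<Rightarrow> K G\<close> of \<open>\<sigma> : F \<Rightarrow> G\<close> with a
  pseudofunctor \<open>K\<close>.
\<close>

definition pn_precomp ::
    "('o, 'a, 't) pstrans \<Rightarrow> ('o, 'a, 't) psfunctor \<Rightarrow> ('o, 'a, 't) pstrans" where
  "pn_precomp \<sigma> K = \<lparr>pn1 = (\<lambda>A. pn1 \<sigma> (pf0 K A)), pn2 = (\<lambda>f. pn2 \<sigma> (pf1 K f))\<rparr>"

definition pn_postcomp ::
    "('o, 'a, 't) psfunctor \<Rightarrow> ('o, 'a, 't) psfunctor \<Rightarrow> ('o, 'a, 't) psfunctor
      \<Rightarrow> ('o, 'a, 't) pstrans \<Rightarrow> ('o, 'a, 't) pstrans" where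
  "pn_postcomp K F G \<sigma> = \<lparr>pn1 = (\<lambda>A. pf1 K (pn1 \<sigma> A)),
     pn2 = (\<lambda>f. pf_square K (pf1 G f) (pn1 \<sigma> (dom1 V f)) (pn2 \<sigma> f)
                            (pn1 \<sigma> (cod1 V f)) (pf1 F f))\<rparr>"

end

text \<open>
  A pseudoadjunction \<open>F \<stileturn> G\<close> with unit \<open>\<eta> : Id \<Rightarrow> G F\<close>, counit \<open>\<epsilon> : F G \<Rightarrow> Id\<close> and
  triangulators \<open>s : 1 \<Rightarrow> \<epsilon>F \<cdot> F\<eta>\<close>, \<open>t : G\<epsilon> \<cdot> \<eta>G \<Rightarrow> 1\<close>.
\<close>

locale pseudoadjunction = F: pseudofunctor V F + G: pseudofunctor V G
  for V :: "('o, 'a, 't, 'z) two_cat_scheme" (structure)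
    and F G :: "('o, 'a, 't) psfunctor" +
  fixes \<eta> \<epsilon> :: "('o, 'a, 't) pstrans" and s t :: "'o \<Rightarrow> 't"
  assumes unit: "pseudonatural V (pf_id V) (pf_compose V G F) \<eta>"
    and counit: "pseudonatural V (pf_compose V F G) (pf_id V) \<epsilon>"
    and s_mod: "modification V F F (pn_id V F)
          (pn_compose V (pn_precomp \<epsilon> F) (pn_postcomp V F (pf_id V) (pf_compose V G F) \<eta>)) s"
    and s_inv: "invertible2 V (s B)"
    and t_mod: "modification V G G
          (pn_compose V (pn_postcomp V G (pf_compose V F G) (pf_id V) \<epsilon>) (pn_precomp \<eta> G))
          (pn_id V G) t"
    and t_inv: "invertible2 V (t B)"
    and swallowtail_unit:
      "(t (pf0 F B) \<lhd> pn1 \<eta> B)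
        \<bullet> (pf1 G (pn1 \<epsilon> (pf0 F B)) \<rhd> pn2 \<eta> (pn1 \<eta> B))
        \<bullet> (pf_cotriangle V G (pf0 F B) (s B) (pn1 \<epsilon> (pf0 F B)) (pf1 F (pn1 \<eta> B)) \<lhd> pn1 \<eta> B)
       = \<i> (pn1 \<eta> B)"
    and swallowtail_counit:
      "(pn1 \<epsilon> B \<rhd> pf_triangle V F (pf1 G (pn1 \<epsilon> B)) (pn1 \<eta> (pf0 G B)) (t B) (pf0 G B))
        \<bullet> (pn2 \<epsilon> (pn1 \<epsilon> B) \<lhd> pf1 F (pn1 \<eta> (pf0 G B)))
        \<bullet> (pn1 \<epsilon> B \<rhd> s (pf0 G B))
       = \<i> (pn1 \<epsilon> B)"


section \<open>Gray monoids\<close>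

text \<open>
  A monoid for the Gray tensor product, unfolded: an object \<open>\<one>\<^sub>\<otimes>\<close>, 2-functors \<open>A \<otimes> -\<close>
  and \<open>- \<otimes> B\<close> that agree on objects and are strictly associative and unital, and
  interchangers \<open>\<Sigma> f g\<close>.  The 2-functor \<open>A \<otimes> -\<close> is written \<open>A \<ltimes> g\<close> on 1-cells and
  \<open>A \<ltimes>\<^sub>2 \<phi>\<close> on 2-cells; \<open>- \<otimes> B\<close> is written \<open>f \<rtimes> B\<close> and \<open>\<theta> \<rtimes>\<^sub>2 B\<close>.
\<close>

record ('o, 'a, 't) gray = "('o, 'a, 't) two_cat" +
  tunit :: "'o"  ("\<one>\<^sub>\<otimes>\<index>")
  tensor :: "'o \<Rightarrow> 'o \<Rightarrow> 'o"  (infixr "\<otimes>\<index>" 85)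
  ltensor1 :: "'o \<Rightarrow> 'a \<Rightarrow> 'a"  (infixr "\<ltimes>\<index>" 80)
  ltensor2 :: "'o \<Rightarrow> 't \<Rightarrow> 't"  (infixr "\<ltimes>\<^sub>2\<index>" 80)
  rtensor1 :: "'a \<Rightarrow> 'o \<Rightarrow> 'a"  (infixl "\<rtimes>\<index>" 81)
  rtensor2 :: "'t \<Rightarrow> 'o \<Rightarrow> 't"  (infixl "\<rtimes>\<^sub>2\<index>" 81)
  interchanger :: "'a \<Rightarrow> 'a \<Rightarrow> 't"  ("\<Sigma>\<index>")

locale gray_monoid = two_category V
  for V :: "('o, 'a, 't, 'z) gray_scheme" (structure) +
  assumes ltensor_functor: "two_functor V (\<lambda>B. A \<otimes> B) (\<lambda>g. A \<ltimes> g) (\<lambda>\<phi>. A \<ltimes>\<^sub>2 \<phi>)"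
    and rtensor_functor: "two_functor V (\<lambda>A. A \<otimes> B) (\<lambda>f. f \<rtimes> B) (\<lambda>\<theta>. \<theta> \<rtimes>\<^sub>2 B)"
    and tensor_unit_left: "\<one>\<^sub>\<otimes> \<otimes> A = A" "\<one>\<^sub>\<otimes> \<ltimes> f = f" "\<one>\<^sub>\<otimes> \<ltimes>\<^sub>2 \<theta> = \<theta>"
    and tensor_unit_right: "A \<otimes> \<one>\<^sub>\<otimes> = A" "f \<rtimes> \<one>\<^sub>\<otimes> = f" "\<theta> \<rtimes>\<^sub>2 \<one>\<^sub>\<otimes> = \<theta>"
    and tensor_assoc: "(A \<otimes> B) \<otimes> C = A \<otimes> (B \<otimes> C)"
    and tensor_assoc1: "(A \<otimes> B) \<ltimes> f = A \<ltimes> (B \<ltimes> f)" "(A \<ltimes> f) \<rtimes> B = A \<ltimes> (f \<rtimes> B)"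
          "f \<rtimes> (A \<otimes> B) = (f \<rtimes> A) \<rtimes> B"
    and tensor_assoc2: "(A \<otimes> B) \<ltimes>\<^sub>2 \<theta> = A \<ltimes>\<^sub>2 (B \<ltimes>\<^sub>2 \<theta>)"
          "(A \<ltimes>\<^sub>2 \<theta>) \<rtimes>\<^sub>2 B = A \<ltimes>\<^sub>2 (\<theta> \<rtimes>\<^sub>2 B)" "\<theta> \<rtimes>\<^sub>2 (A \<otimes> B) = (\<theta> \<rtimes>\<^sub>2 A) \<rtimes>\<^sub>2 B"
    and interchanger_iso: "\<lbrakk>f \<in> hom1 V A A'; g \<in> hom1 V B B'\<rbrakk>
          \<Longrightarrow> \<Sigma> f g \<in> iso2 V ((f \<rtimes> B') \<cdot> (A \<ltimes> g)) ((A' \<ltimes> g) \<cdot> (f \<rtimes> B))"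
    and interchanger_natural: "\<lbrakk>f \<in> hom1 V A A'; g \<in> hom1 V B B';
          \<theta> \<in> hom2 V f f'; \<phi> \<in> hom2 V g g'\<rbrakk>
          \<Longrightarrow> \<Sigma> f' g' \<bullet> ((\<theta> \<rtimes>\<^sub>2 B') \<star> (A \<ltimes>\<^sub>2 \<phi>)) = ((A' \<ltimes>\<^sub>2 \<phi>) \<star> (\<theta> \<rtimes>\<^sub>2 B)) \<bullet> \<Sigma> f g"
    and interchanger_id_left: "g \<in> hom1 V B B' \<Longrightarrow> \<Sigma> (\<one> A) g = \<i> (A \<ltimes> g)"
    and interchanger_id_right: "f \<in> hom1 V A A' \<Longrightarrow> \<Sigma> f (\<one> B) = \<i> (f \<rtimes> B)"
    and interchanger_comp_left: "\<lbrakk>f \<in> hom1 V A A'; f' \<in> hom1 V A' A''; g \<in> hom1 V B B'\<rbrakk>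
          \<Longrightarrow> \<Sigma> (f' \<cdot> f) g = (\<Sigma> f' g \<lhd> (f \<rtimes> B)) \<bullet> ((f' \<rtimes> B') \<rhd> \<Sigma> f g)"
    and interchanger_comp_right: "\<lbrakk>f \<in> hom1 V A A'; g \<in> hom1 V B B'; g' \<in> hom1 V B' B''\<rbrakk>
          \<Longrightarrow> \<Sigma> f (g' \<cdot> g) = ((A' \<ltimes> g') \<rhd> \<Sigma> f g) \<bullet> (\<Sigma> f g' \<lhd> (A \<ltimes> g))"
    and interchanger_tensor: "\<Sigma> (A \<ltimes> f) g = A \<ltimes>\<^sub>2 \<Sigma> f g" "\<Sigma> (f \<rtimes> A) g = \<Sigma> f (A \<ltimes> g)"
          "\<Sigma> f (g \<rtimes> A) = \<Sigma> f g \<rtimes>\<^sub>2 A"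

text \<open>The 2-functor \<open>- \<otimes> A\<close> as a pseudofunctor.\<close>

definition rtensor_pf :: "('o, 'a, 't, 'z) gray_scheme \<Rightarrow> 'o \<Rightarrow> ('o, 'a, 't) psfunctor" where
  "rtensor_pf V A = \<lparr>pf0 = (\<lambda>B. tensor V B A), pf1 = (\<lambda>f. rtensor1 V f A),
     pf2 = (\<lambda>\<theta>. rtensor2 V \<theta> A),
     pf_comp = (\<lambda>g f. id2 V (rtensor1 V (comp1 V g f) A)),
     pf_unit = (\<lambda>B. id2 V (id1 V (tensor V B A)))\<rparr>"


section \<open>Right closed Gray monoids\<close>

record ('o, 'a, 't) closed_gray = "('o, 'a, 't) gray" +
  ihom :: "'o \<Rightarrow> ('o, 'a, 't) psfunctor"
  coev :: "'o \<Rightarrow> ('o, 'a, 't) pstrans"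
  eval :: "'o \<Rightarrow> ('o, 'a, 't) pstrans"
  tri_s :: "'o \<Rightarrow> 'o \<Rightarrow> 't"
  tri_t :: "'o \<Rightarrow> 'o \<Rightarrow> 't"

locale right_closed_gray_monoid = gray_monoid V
  for V :: "('o, 'a, 't, 'z) closed_gray_scheme" (structure) +
  assumes tensor_hom_adjunction:
    "pseudoadjunction V (rtensor_pf V A) (ihom V A) (coev V A) (eval V A) (tri_s V A) (tri_t V A)"


section \<open>Bicategories enriched over a Gray monoid\<close>

text \<open>
  \<open>vmult C c d e : C(d,e) \<otimes> C(c,d) \<rightarrow> C(c,e)\<close>, and \<open>vassoc C b c d e\<close> lives on
  \<open>C(d,e) \<otimes> C(c,d) \<otimes> C(b,c)\<close>; \<open>vlunit C c d\<close> and \<open>vrunit C c d\<close> live on \<open>C(c,d)\<close>.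
\<close>

record ('x, 'o, 'a, 't) enriched_bicat =
  vobj :: "'x set"
  vhom :: "'x \<Rightarrow> 'x \<Rightarrow> 'o"
  vmult :: "'x \<Rightarrow> 'x \<Rightarrow> 'x \<Rightarrow> 'a"
  vunit :: "'x \<Rightarrow> 'a"
  vassoc :: "'x \<Rightarrow> 'x \<Rightarrow> 'x \<Rightarrow> 'x \<Rightarrow> 't"
  vlunit :: "'x \<Rightarrow> 'x \<Rightarrow> 't"
  vrunit :: "'x \<Rightarrow> 'x \<Rightarrow> 't"

locale enriched_bicategory = gray_monoid V
  for V :: "('o, 'a, 't, 'z) gray_scheme" (structure) +
  fixes C :: "('x, 'o, 'a, 't) enriched_bicat"
  assumes vmult_hom: "\<lbrakk>c \<in> vobj C; d \<in> vobj C; e \<in> vobj C\<rbrakk>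
          \<Longrightarrow> vmult C c d e \<in> hom1 V (vhom C d e \<otimes> vhom C c d) (vhom C c e)"
    and vunit_hom: "c \<in> vobj C \<Longrightarrow> vunit C c \<in> hom1 V \<one>\<^sub>\<otimes> (vhom C c c)"
    and vassoc_iso: "\<lbrakk>b \<in> vobj C; c \<in> vobj C; d \<in> vobj C; e \<in> vobj C\<rbrakk>
          \<Longrightarrow> vassoc C b c d e \<in> iso2 V
                (vmult C b c e \<cdot> (vmult C c d e \<rtimes> vhom C b c))
                (vmult C b d e \<cdot> (vhom C d e \<ltimes> vmult C b c d))"
    and vlunit_iso: "\<lbrakk>c \<in> vobj C; d \<in> vobj C\<rbrakk>
          \<Longrightarrow> vlunit C c d \<in> iso2 V (vmult C c d d \<cdot> (vunit C d \<rtimes> vhom C c d)) (\<one> (vhom C c d))"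
    and vrunit_iso: "\<lbrakk>c \<in> vobj C; d \<in> vobj C\<rbrakk>
          \<Longrightarrow> vrunit C c d \<in> iso2 V (vmult C c c d \<cdot> (vhom C c d \<ltimes> vunit C c)) (\<one> (vhom C c d))"
    and IC: "\<lbrakk>c \<in> vobj C; d \<in> vobj C; e \<in> vobj C\<rbrakk>
          \<Longrightarrow> (vmult C c d e \<rhd> (vhom C d e \<ltimes>\<^sub>2 vlunit C c d))
                \<bullet> (vassoc C c d d e \<lhd> (vhom C d e \<ltimes> (vunit C d \<rtimes> vhom C c d)))
              = vmult C c d e \<rhd> (vrunit C d e \<rtimes>\<^sub>2 vhom C c d)"
    and AC: "\<lbrakk>b \<in> vobj C; c \<in> vobj C; d \<in> vobj C; e \<in> vobj C; f \<in> vobj C\<rbrakk>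
          \<Longrightarrow> (vmult C b e f \<rhd> (vhom C e f \<ltimes>\<^sub>2 vassoc C b c d e))
                \<bullet> (vassoc C b c e f \<lhd> (vhom C e f \<ltimes> (vmult C c d e \<rtimes> vhom C b c)))
                \<bullet> (vmult C b c f \<rhd> (vassoc C c d e f \<rtimes>\<^sub>2 vhom C b c))
              = (vassoc C b d e f \<lhd> ((vhom C e f \<otimes> vhom C d e) \<ltimes> vmult C b c d))
                \<bullet> (vmult C b d f \<rhd> inv2 V (\<Sigma> (vmult C d e f) (vmult C b c d)))
                \<bullet> (vassoc C b c d f \<lhd> (vmult C d e f \<rtimes> (vhom C c d \<otimes> vhom C b c)))"


section \<open>The canonical enrichment of a right closed Gray monoid over itself\<close>

text \<open>
  In the composites below each line is one arrow of the pasting, the last arrow first.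
\<close>

context
  fixes V :: "('o, 'a, 't, 'z) closed_gray_scheme" (structure)
begin

definition hm :: "'o \<Rightarrow> 'o \<Rightarrow> 'o" where
  "hm a b = pf0 (ihom V a) b"

definition ev :: "'o \<Rightarrow> 'o \<Rightarrow> 'a" where
  "ev a b = pn1 (eval V a) b"

definition self_mult :: "'o \<Rightarrow> 'o \<Rightarrow> 'o \<Rightarrow> 'a" where
  "self_mult a b c =
     pf1 (ihom V a) (ev b c)
     \<cdot> pf1 (ihom V a) (hm b c \<ltimes> ev a b)
     \<cdot> pn1 (coev V a) (hm b c \<otimes> hm a b)"

definition self_unit :: "'o \<Rightarrow> 'a" where
  "self_unit a = pn1 (coev V a) \<one>\<^sub>\<otimes>"

text \<open>\<open>self_e a b c : ev a c \<cdot> (m \<rtimes> a) \<Rightarrow> ev b c \<cdot> (hm b c \<ltimes> ev a b)\<close>.\<close>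

definition self_e :: "'o \<Rightarrow> 'o \<Rightarrow> 'o \<Rightarrow> 't" where
  "self_e a b c =
    (let G = ihom V a; k = hm b c \<ltimes> ev a b; B = hm b c \<otimes> hm a b; \<eta>B = pn1 (coev V a) B \<rtimes> a
     in ((ev b c \<cdot> k) \<rhd> inv2 V (tri_s V a B))
        \<bullet> (ev b c \<rhd> inv2 V (pn2 (eval V a) k) \<lhd> \<eta>B)
        \<bullet> (inv2 V (pn2 (eval V a) (ev b c)) \<lhd> ((pf1 G k \<rtimes> a) \<cdot> \<eta>B)))"

definition self_assoc :: "'o \<Rightarrow> 'o \<Rightarrow> 'o \<Rightarrow> 'o \<Rightarrow> 't" where
  "self_assoc a b c d =
    (let G = ihom V a; H = hm c d \<otimes> hm b c; \<eta>P = pn1 (coev V a) (H \<otimes> hm a b);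
         m = self_mult b c d; n = self_mult a b c
     in ((pf1 G (ev c d) \<cdot> pf1 G (hm c d \<ltimes> ev a c)) \<rhd> pn2 (coev V a) (hm c d \<ltimes> n))
        \<bullet> (pf1 G (ev c d)
            \<rhd> pf_square V G (hm c d \<ltimes> ev b c) (H \<ltimes> ev a b)
                 (hm c d \<ltimes>\<^sub>2 inv2 V (self_e a b c))
                 (hm c d \<ltimes> ev a c) (hm c d \<ltimes> (n \<rtimes> a))
            \<lhd> \<eta>P)
        \<bullet> (pf_square V G (ev b d) (m \<rtimes> b) (self_e b c d) (ev c d) (hm c d \<ltimes> ev b c)
            \<lhd> (pf1 G (H \<ltimes> ev a b) \<cdot> \<eta>P))
        \<bullet> (pf1 G (ev b d)
            \<rhd> pf_square V G (hm b d \<ltimes> ev a b) (m \<rtimes> (hm a b \<otimes> a))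
                 (inv2 V (\<Sigma> m (ev a b)))
                 (m \<rtimes> b) (H \<ltimes> ev a b)
            \<lhd> \<eta>P)
        \<bullet> ((pf1 G (ev b d) \<cdot> pf1 G (hm b d \<ltimes> ev a b)) \<rhd> inv2 V (pn2 (coev V a) (m \<rtimes> hm a b))))"

definition self_lunit :: "'o \<Rightarrow> 'o \<Rightarrow> 't" where
  "self_lunit a b =
    (let G = ihom V a; \<eta>H = pn1 (coev V a) (hm a b); u = self_unit b
     in tri_t V a b
        \<bullet> (pf_triangle V G (ev b b) (u \<rtimes> b) (inv2 V (tri_s V b \<one>\<^sub>\<otimes>)) b
            \<lhd> (pf1 G (ev a b) \<cdot> \<eta>H))
        \<bullet> (pf1 G (ev b b)
            \<rhd> pf_square V G (hm b b \<ltimes> ev a b) (u \<rtimes> (hm a b \<otimes> a))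
                 (inv2 V (\<Sigma> u (ev a b)))
                 (u \<rtimes> b) (ev a b)
            \<lhd> \<eta>H)
        \<bullet> ((pf1 G (ev b b) \<cdot> pf1 G (hm b b \<ltimes> ev a b)) \<rhd> inv2 V (pn2 (coev V a) (u \<rtimes> hm a b))))"

definition self_runit :: "'o \<Rightarrow> 'o \<Rightarrow> 't" where
  "self_runit a b =
    (let G = ihom V a; \<eta>H = pn1 (coev V a) (hm a b); u = self_unit a
     in tri_t V a b
        \<bullet> (pf1 G (ev a b)
            \<rhd> pf_triangle V G (hm a b \<ltimes> ev a a) (hm a b \<ltimes> (u \<rtimes> a))
                 (hm a b \<ltimes>\<^sub>2 inv2 V (tri_s V a \<one>\<^sub>\<otimes>)) (hm a b \<otimes> a)
            \<lhd> \<eta>H)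
        \<bullet> ((pf1 G (ev a b) \<cdot> pf1 G (hm a b \<ltimes> ev a a)) \<rhd> inv2 V (pn2 (coev V a) (hm a b \<ltimes> u))))"

definition self_enrichment :: "('o, 'o, 'a, 't) enriched_bicat" where
  "self_enrichment = \<lparr>vobj = UNIV, vhom = hm, vmult = self_mult, vunit = self_unit,
     vassoc = self_assoc, vlunit = self_lunit, vrunit = self_runit\<rparr>"

end

end

theory Submission
  imports Defs
begin

text \<open>
  By right closedness a 2-cell \<open>\<theta>\<close> between 1-cells \<open>X \<rightarrow> [a,c]\<close> is determined by the 2-cell
  \<open>\<epsilon>(\<theta>1)\<close> between 1-cells \<open>Xa \<rightarrow> c\<close>.  With \<open>d = e\<^sup>-\<^sup>1\<close>, the definitions of the structural cells,
  pseudonaturality of \<open>\<epsilon>\<close>, the modification axiom for \<open>s\<close> and one swallowtail equation give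
  \<open>\<epsilon>(\<alpha>1) \<bullet> d \<bullet> \<Sigma> \<bullet> d = d \<bullet> d\<close>, \<open>\<epsilon>(\<lambda>1) \<bullet> d \<bullet> \<Sigma> \<bullet> s = 1\<close> and \<open>\<epsilon>(\<rho>1) \<bullet> d \<bullet> s = 1\<close>, whiskerings
  suppressed.  After applying \<open>\<epsilon>(-1)\<close> and precomposing with an invertible pasting of cells \<open>d\<close>, \<open>\<Sigma>\<close>
  and \<open>s\<close>, both axioms follow from these three equations and the naturality of the interchanger.
\<close>


text \<open>Compared directly, the two sides of either axiom are pastings full of coherence cells of
  \<open>ihom V a\<close> and pseudonaturality cells of \<eta>. Transposition removes both kinds. A
  pseudonaturality cell of \<eta> becomes an identity; this is what the modification axiom for
  \<open>s\<close> says. The compositors and unit cells hidden in \<open>pf_square\<close> and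
  \<open>pf_triangle\<close> cancel against those in the pseudonaturality of \<epsilon> at a
  composite or an identity. Only cells \<open>d\<close>, \<open>s\<close> and interchangers of the
  Gray monoid survive. The swallowtail equation enters through the cell \<open>t\<close> that ends
  both \<lambda> and \<rho>: it says that \<open>t\<close> transposes to an identity. The cell
  \<open>d\<close> is preferred to \<open>e\<close> because it is a composite of \<open>s\<close>
  and cells of \<epsilon> without inverses, and because it is exactly the comparison that exhibits
  \<open>m\<close> as the transpose of \<epsilon>(1\<epsilon>). The pasting used for precomposition
  is the comparison belonging to the common source of the two sides of an axiom. It is assembled so
  that the equations for \<alpha>, \<lambda> and \<rho> can be applied to consecutive factors of it,
  and its invertibility allows it to be cancelled at the end.\<close>

section \<open>Calculus in a 2-category\<close>

context two_category
begin

lemma dom1_id1 [simp]: "dom1 V (\<one> A) = A"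
  and cod1_id1 [simp]: "cod1 V (\<one> A) = A"
  using id1_hom[of A] by (auto simp: hom1_def)

text \<open>Every element of the type of 1-cells lies in the hom-set of its own ends. Membership
  hypotheses of the locale thus turn into equations between ends, which the simplifier can
  discharge; the same device is used for 2-cells and for all later operations.\<close>

lemma dom1_comp1 [simp]: "cod1 V f = dom1 V g \<Longrightarrow> dom1 V (g \<cdot> f) = dom1 V f"
  and cod1_comp1 [simp]: "cod1 V f = dom1 V g \<Longrightarrow> cod1 V (g \<cdot> f) = cod1 V g"
  using comp1_hom[of f "dom1 V f" "dom1 V g" g "cod1 V g"] by (auto simp: hom1_def)

lemma comp1_id1_right [simp]: "dom1 V f = A \<Longrightarrow> f \<cdot> \<one> A = f"
  and comp1_id1_left [simp]: "cod1 V f = B \<Longrightarrow> \<one> B \<cdot> f = f"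
  using comp1_id_right comp1_id_left by (auto simp: hom1_def)

lemma comp1_assoc' [simp]:
  "\<lbrakk>cod1 V f = dom1 V g; cod1 V g = dom1 V h\<rbrakk> \<Longrightarrow> (h \<cdot> g) \<cdot> f = h \<cdot> g \<cdot> f"
  using comp1_assoc by (auto simp: hom1_def)

lemma dom1_cod2 [simp]: "dom1 V (cod2 V \<theta>) = dom1 V (dom2 V \<theta>)"
  and cod1_cod2 [simp]: "cod1 V (cod2 V \<theta>) = cod1 V (dom2 V \<theta>)"
  using globular_dom globular_cod by auto

lemma dom2_id2 [simp]: "dom2 V (\<i> f) = f"
  and cod2_id2 [simp]: "cod2 V (\<i> f) = f"
  using id2_hom[of f] by (auto simp: hom2_def)

lemma dom2_vcomp [simp]: "cod2 V \<theta> = dom2 V \<phi> \<Longrightarrow> dom2 V (\<phi> \<bullet> \<theta>) = dom2 V \<theta>"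
  and cod2_vcomp [simp]: "cod2 V \<theta> = dom2 V \<phi> \<Longrightarrow> cod2 V (\<phi> \<bullet> \<theta>) = cod2 V \<phi>"
  using vcomp_hom[of \<theta> "dom2 V \<theta>" "dom2 V \<phi>" \<phi> "cod2 V \<phi>"] by (auto simp: hom2_def)

lemma vcomp_id2_right [simp]: "dom2 V \<theta> = f \<Longrightarrow> \<theta> \<bullet> \<i> f = \<theta>"
  and vcomp_id2_left [simp]: "cod2 V \<theta> = f \<Longrightarrow> \<i> f \<bullet> \<theta> = \<theta>"
  using vcomp_id_right vcomp_id_left by (auto simp: hom2_def)

lemma vcomp_assoc' [simp]:
  "\<lbrakk>cod2 V \<theta> = dom2 V \<phi>; cod2 V \<phi> = dom2 V \<psi>\<rbrakk> \<Longrightarrow> (\<psi> \<bullet> \<phi>) \<bullet> \<theta> = \<psi> \<bullet> \<phi> \<bullet> \<theta>"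
  using vcomp_assoc by (auto simp: hom2_def)

lemma dom2_hcomp [simp]:
    "cod1 V (dom2 V \<theta>) = dom1 V (dom2 V \<phi>) \<Longrightarrow> dom2 V (\<phi> \<star> \<theta>) = dom2 V \<phi> \<cdot> dom2 V \<theta>"
  and cod2_hcomp [simp]:
    "cod1 V (dom2 V \<theta>) = dom1 V (dom2 V \<phi>) \<Longrightarrow> cod2 V (\<phi> \<star> \<theta>) = cod2 V \<phi> \<cdot> cod2 V \<theta>"
  using hcomp_hom[of "dom2 V \<theta>" _ _ "dom2 V \<phi>" _ \<theta> "cod2 V \<theta>" \<phi> "cod2 V \<phi>"]
  by (auto simp: hom1_def hom2_def)

lemma hcomp_assoc':
  "\<lbrakk>cod1 V (dom2 V \<theta>) = dom1 V (dom2 V \<phi>); cod1 V (dom2 V \<phi>) = dom1 V (dom2 V \<psi>)\<rbrakk>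
    \<Longrightarrow> (\<psi> \<star> \<phi>) \<star> \<theta> = \<psi> \<star> \<phi> \<star> \<theta>"
  using hcomp_assoc[of "dom2 V \<theta>" _ _ "dom2 V \<phi>" _ "dom2 V \<psi>" _ \<theta> "cod2 V \<theta>" \<phi> "cod2 V \<phi>"
      \<psi> "cod2 V \<psi>"]
  by (auto simp: hom1_def hom2_def)

lemma interchange':
  "\<lbrakk>cod1 V (dom2 V \<theta>) = dom1 V (dom2 V \<phi>); cod2 V \<theta> = dom2 V \<theta>'; cod2 V \<phi> = dom2 V \<phi>'\<rbrakk>
    \<Longrightarrow> (\<phi>' \<bullet> \<phi>) \<star> (\<theta>' \<bullet> \<theta>) = (\<phi>' \<star> \<theta>') \<bullet> (\<phi> \<star> \<theta>)"
  using interchange[of "dom2 V \<theta>" _ _ "dom2 V \<phi>" _ \<theta> "cod2 V \<theta>" \<theta>' "cod2 V \<theta>'"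
      \<phi> "cod2 V \<phi>" \<phi>' "cod2 V \<phi>'"]
  by (auto simp: hom1_def hom2_def)

lemma hcomp_id2_id2: "cod1 V f = dom1 V g \<Longrightarrow> \<i> g \<star> \<i> f = \<i> (g \<cdot> f)"
  using hcomp_id2 by (auto simp: hom1_def)

lemma dom2_whisker_left [simp]:
    "cod1 V (dom2 V \<theta>) = dom1 V g \<Longrightarrow> dom2 V (g \<rhd> \<theta>) = g \<cdot> dom2 V \<theta>"
  and cod2_whisker_left [simp]:
    "cod1 V (dom2 V \<theta>) = dom1 V g \<Longrightarrow> cod2 V (g \<rhd> \<theta>) = g \<cdot> cod2 V \<theta>"
  by (simp_all add: whisker_left_def)

lemma dom2_whisker_right [simp]:
    "cod1 V f = dom1 V (dom2 V \<theta>) \<Longrightarrow> dom2 V (\<theta> \<lhd> f) = dom2 V \<theta> \<cdot> f"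
  and cod2_whisker_right [simp]:
    "cod1 V f = dom1 V (dom2 V \<theta>) \<Longrightarrow> cod2 V (\<theta> \<lhd> f) = cod2 V \<theta> \<cdot> f"
  by (simp_all add: whisker_right_def)

lemma whisker_left_id2 [simp]: "cod1 V f = dom1 V g \<Longrightarrow> g \<rhd> \<i> f = \<i> (g \<cdot> f)"
  and whisker_right_id2 [simp]: "cod1 V f = dom1 V g \<Longrightarrow> \<i> g \<lhd> f = \<i> (g \<cdot> f)"
  by (simp_all add: whisker_left_def whisker_right_def hcomp_id2_id2)

lemma whisker_left_id1 [simp]: "cod1 V (dom2 V \<theta>) = B \<Longrightarrow> \<one> B \<rhd> \<theta> = \<theta>"
  and whisker_right_id1 [simp]: "dom1 V (dom2 V \<theta>) = A \<Longrightarrow> \<theta> \<lhd> \<one> A = \<theta>"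
  using hcomp_id_left hcomp_id_right
  by (auto simp: whisker_left_def whisker_right_def hom1_def hom2_def)

lemma whisker_left_vcomp [simp]:
  assumes "cod2 V \<theta> = dom2 V \<phi>" "cod1 V (dom2 V \<theta>) = dom1 V g"
  shows "g \<rhd> (\<phi> \<bullet> \<theta>) = (g \<rhd> \<phi>) \<bullet> (g \<rhd> \<theta>)"
  using assms interchange'[of \<theta> "\<i> g" \<phi> "\<i> g"] by (simp add: whisker_left_def)

lemma whisker_right_vcomp [simp]:
  assumes "cod2 V \<theta> = dom2 V \<phi>" "cod1 V f = dom1 V (dom2 V \<theta>)"
  shows "(\<phi> \<bullet> \<theta>) \<lhd> f = (\<phi> \<lhd> f) \<bullet> (\<theta> \<lhd> f)"
  using assms interchange'[of "\<i> f" \<theta> "\<i> f" \<phi>] by (simp add: whisker_right_def)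

lemma whisker_left_comp1:
  "\<lbrakk>cod1 V (dom2 V \<theta>) = dom1 V f; cod1 V f = dom1 V g\<rbrakk> \<Longrightarrow> (g \<cdot> f) \<rhd> \<theta> = g \<rhd> f \<rhd> \<theta>"
  by (simp add: whisker_left_def hcomp_id2_id2[symmetric] hcomp_assoc')

lemma whisker_right_comp1:
  "\<lbrakk>cod1 V f = dom1 V g; cod1 V g = dom1 V (dom2 V \<theta>)\<rbrakk> \<Longrightarrow> \<theta> \<lhd> (g \<cdot> f) = \<theta> \<lhd> g \<lhd> f"
  by (simp add: whisker_right_def hcomp_id2_id2[symmetric] hcomp_assoc')

text \<open>The orientation fixes a normal form. Together with \<open>whisker_left_right\<close> and
  the distribution over \<open>\<bullet>\<close>, every iterated whiskering becomes one whiskering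
  by a composite on each side, so equal pastings are identified by rewriting.\<close>

lemma whisker_left_whisker_left [simp]:
  "\<lbrakk>cod1 V (dom2 V \<theta>) = dom1 V f; cod1 V f = dom1 V g\<rbrakk> \<Longrightarrow> g \<rhd> f \<rhd> \<theta> = (g \<cdot> f) \<rhd> \<theta>"
  by (simp add: whisker_left_comp1)

lemma whisker_right_whisker_right [simp]:
  "\<lbrakk>cod1 V f = dom1 V g; cod1 V g = dom1 V (dom2 V \<theta>)\<rbrakk> \<Longrightarrow> \<theta> \<lhd> g \<lhd> f = \<theta> \<lhd> (g \<cdot> f)"
  by (simp add: whisker_right_comp1)

lemma whisker_left_right [simp]:
  "\<lbrakk>cod1 V f = dom1 V (dom2 V \<theta>); cod1 V (dom2 V \<theta>) = dom1 V g\<rbrakk>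
    \<Longrightarrow> (g \<rhd> \<theta>) \<lhd> f = g \<rhd> (\<theta> \<lhd> f)"
  by (simp add: whisker_left_def whisker_right_def hcomp_assoc')

lemma hcomp_eq_right_left:
  assumes "cod1 V (dom2 V \<theta>) = dom1 V (dom2 V \<phi>)"
  shows "\<phi> \<star> \<theta> = (\<phi> \<lhd> cod2 V \<theta>) \<bullet> (dom2 V \<phi> \<rhd> \<theta>)"
  using assms interchange'[of \<theta> "\<i> (dom2 V \<phi>)" "\<i> (cod2 V \<theta>)" \<phi>]
  by (simp add: whisker_left_def whisker_right_def)

lemma hcomp_eq_left_right:
  assumes "cod1 V (dom2 V \<theta>) = dom1 V (dom2 V \<phi>)"
  shows "\<phi> \<star> \<theta> = (cod2 V \<phi> \<rhd> \<theta>) \<bullet> (\<phi> \<lhd> dom2 V \<theta>)"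
  using assms interchange'[of "\<i> (dom2 V \<theta>)" \<phi> \<theta> "\<i> (cod2 V \<phi>)"]
  by (simp add: whisker_left_def whisker_right_def)

text \<open>Both sides are the horizontal composite \<open>\<phi> \<star> \<theta>\<close>. This is
  how cells on disjoint parts of a pasting slide past each other; the ends are separate variables so
  that they can be supplied by \<open>refl\<close> or matched after simplification.\<close>

lemma whisker_exchange:
  assumes "cod1 V (dom2 V \<theta>) = dom1 V (dom2 V \<phi>)"
    and "dom2 V \<theta> = f" "cod2 V \<theta> = f'" "dom2 V \<phi> = g" "cod2 V \<phi> = g'"
  shows "(\<phi> \<lhd> f') \<bullet> (g \<rhd> \<theta>) = (g' \<rhd> \<theta>) \<bullet> (\<phi> \<lhd> f)"
  using assms hcomp_eq_right_left[of \<theta> \<phi>] hcomp_eq_left_right[of \<theta> \<phi>] by simp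

text \<open>Vertical composites are kept nested to the right, so an equation between shorter
  composites does not match at the head of a longer one; this prolongs it by
  \<open>\<xi>\<close>.\<close>

lemma vcomp_left_cong:
  assumes "\<phi> \<bullet> \<theta> = \<phi>' \<bullet> \<theta>'"
    and "cod2 V \<xi> = dom2 V \<theta>" "cod2 V \<theta> = dom2 V \<phi>"
    and "cod2 V \<xi> = dom2 V \<theta>'" "cod2 V \<theta>' = dom2 V \<phi>'"
  shows "\<phi> \<bullet> \<theta> \<bullet> \<xi> = \<phi>' \<bullet> \<theta>' \<bullet> \<xi>"
proof -
  have "\<phi> \<bullet> \<theta> \<bullet> \<xi> = (\<phi> \<bullet> \<theta>) \<bullet> \<xi>"
    using assms(2,3) by simp
  also have "\<dots> = (\<phi>' \<bullet> \<theta>') \<bullet> \<xi>"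
    by (simp only: assms(1))
  also have "\<dots> = \<phi>' \<bullet> \<theta>' \<bullet> \<xi>"
    using assms(4,5) by simp
  finally show ?thesis .
qed


subsection \<open>Invertible 2-cells\<close>

lemma is_inv2_unique:
  assumes "is_inv2 V \<theta> \<phi>" "is_inv2 V \<theta> \<psi>"
  shows "\<phi> = \<psi>"
proof -
  have "\<phi> = \<phi> \<bullet> \<theta> \<bullet> \<psi>"
    using assms by (simp add: is_inv2_def)
  also have "\<dots> = (\<phi> \<bullet> \<theta>) \<bullet> \<psi>"
    using assms by (intro vcomp_assoc'[symmetric]) (simp_all add: is_inv2_def)
  also have "\<dots> = \<psi>"
    using assms by (simp add: is_inv2_def)
  finally show ?thesis .
qed

lemma invertible2I: "is_inv2 V \<theta> \<phi> \<Longrightarrow> invertible2 V \<theta>"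
  unfolding invertible2_def by blast

lemma inv2_eqI: "is_inv2 V \<theta> \<phi> \<Longrightarrow> inv2 V \<theta> = \<phi>"
  unfolding inv2_def by (rule the_equality) (auto intro: is_inv2_unique)

lemma is_inv2_inv2: "invertible2 V \<theta> \<Longrightarrow> is_inv2 V \<theta> (inv2 V \<theta>)"
  unfolding invertible2_def by (metis inv2_eqI)

lemma is_inv2_sym: "is_inv2 V \<theta> \<phi> \<Longrightarrow> is_inv2 V \<phi> \<theta>"
  by (simp add: is_inv2_def)

lemma invertible2_inv2 [simp]: "invertible2 V \<theta> \<Longrightarrow> invertible2 V (inv2 V \<theta>)"
  by (rule invertible2I[OF is_inv2_sym[OF is_inv2_inv2]])

lemma inv2_inv2 [simp]: "invertible2 V \<theta> \<Longrightarrow> inv2 V (inv2 V \<theta>) = \<theta>"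
  by (rule inv2_eqI[OF is_inv2_sym[OF is_inv2_inv2]])

lemma dom2_inv2 [simp]: "invertible2 V \<theta> \<Longrightarrow> dom2 V (inv2 V \<theta>) = cod2 V \<theta>"
  and cod2_inv2 [simp]: "invertible2 V \<theta> \<Longrightarrow> cod2 V (inv2 V \<theta>) = dom2 V \<theta>"
  and inv2_vcomp_self [simp]: "invertible2 V \<theta> \<Longrightarrow> inv2 V \<theta> \<bullet> \<theta> = \<i> (dom2 V \<theta>)"
  and vcomp_inv2_self [simp]: "invertible2 V \<theta> \<Longrightarrow> \<theta> \<bullet> inv2 V \<theta> = \<i> (cod2 V \<theta>)"
  using is_inv2_inv2[of \<theta>] by (simp_all add: is_inv2_def)

lemma inv2_vcomp_cancel [simp]:
  "\<lbrakk>invertible2 V \<theta>; cod2 V \<phi> = dom2 V \<theta>\<rbrakk> \<Longrightarrow> inv2 V \<theta> \<bullet> \<theta> \<bullet> \<phi> = \<phi>"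
  by (subst vcomp_assoc'[symmetric]) simp_all

lemma vcomp_inv2_cancel [simp]:
  "\<lbrakk>invertible2 V \<theta>; cod2 V \<phi> = cod2 V \<theta>\<rbrakk> \<Longrightarrow> \<theta> \<bullet> inv2 V \<theta> \<bullet> \<phi> = \<phi>"
  by (subst vcomp_assoc'[symmetric]) simp_all

lemma is_inv2_id2: "is_inv2 V (\<i> f) (\<i> f)"
  by (simp add: is_inv2_def)

lemma invertible2_id2 [simp]: "invertible2 V (\<i> f)"
  by (rule invertible2I[OF is_inv2_id2])

lemma inv2_id2 [simp]: "inv2 V (\<i> f) = \<i> f"
  by (rule inv2_eqI) (rule is_inv2_id2)

lemma is_inv2_vcomp:
  assumes "invertible2 V \<theta>" "invertible2 V \<phi>" "cod2 V \<theta> = dom2 V \<phi>"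
  shows "is_inv2 V (\<phi> \<bullet> \<theta>) (inv2 V \<theta> \<bullet> inv2 V \<phi>)"
  using assms by (simp add: is_inv2_def)

lemma is_inv2_whisker_left:
  assumes "invertible2 V \<theta>" "cod1 V (dom2 V \<theta>) = dom1 V g"
  shows "is_inv2 V (g \<rhd> \<theta>) (g \<rhd> inv2 V \<theta>)"
  using assms by (simp add: is_inv2_def whisker_left_vcomp[symmetric] del: whisker_left_vcomp)

lemma is_inv2_whisker_right:
  assumes "invertible2 V \<theta>" "cod1 V f = dom1 V (dom2 V \<theta>)"
  shows "is_inv2 V (\<theta> \<lhd> f) (inv2 V \<theta> \<lhd> f)"
  using assms by (simp add: is_inv2_def whisker_right_vcomp[symmetric] del: whisker_right_vcomp)

lemma invertible2_vcomp [simp]: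
  "\<lbrakk>invertible2 V \<theta>; invertible2 V \<phi>; cod2 V \<theta> = dom2 V \<phi>\<rbrakk> \<Longrightarrow> invertible2 V (\<phi> \<bullet> \<theta>)"
  by (rule invertible2I[OF is_inv2_vcomp])

lemma invertible2_whisker_left [simp]:
  "\<lbrakk>invertible2 V \<theta>; cod1 V (dom2 V \<theta>) = dom1 V g\<rbrakk> \<Longrightarrow> invertible2 V (g \<rhd> \<theta>)"
  by (rule invertible2I[OF is_inv2_whisker_left])

lemma invertible2_whisker_right [simp]:
  "\<lbrakk>invertible2 V \<theta>; cod1 V f = dom1 V (dom2 V \<theta>)\<rbrakk> \<Longrightarrow> invertible2 V (\<theta> \<lhd> f)"
  by (rule invertible2I[OF is_inv2_whisker_right])

lemma inv2_vcomp:
  "\<lbrakk>invertible2 V \<theta>; invertible2 V \<phi>; cod2 V \<theta> = dom2 V \<phi>\<rbrakk>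
    \<Longrightarrow> inv2 V (\<phi> \<bullet> \<theta>) = inv2 V \<theta> \<bullet> inv2 V \<phi>"
  by (rule inv2_eqI[OF is_inv2_vcomp])

lemma inv2_whisker_left:
  "\<lbrakk>invertible2 V \<theta>; cod1 V (dom2 V \<theta>) = dom1 V g\<rbrakk> \<Longrightarrow> inv2 V (g \<rhd> \<theta>) = g \<rhd> inv2 V \<theta>"
  by (rule inv2_eqI[OF is_inv2_whisker_left])

lemma inv2_whisker_right:
  "\<lbrakk>invertible2 V \<theta>; cod1 V f = dom1 V (dom2 V \<theta>)\<rbrakk> \<Longrightarrow> inv2 V (\<theta> \<lhd> f) = inv2 V \<theta> \<lhd> f"
  by (rule inv2_eqI[OF is_inv2_whisker_right])

lemma vcomp_right_cancel:
  assumes "\<phi> \<bullet> \<theta> = \<psi> \<bullet> \<theta>" "invertible2 V \<theta>" "dom2 V \<phi> = cod2 V \<theta>" "dom2 V \<psi> = cod2 V \<theta>"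
  shows "\<phi> = \<psi>"
proof -
  have "(\<phi> \<bullet> \<theta>) \<bullet> inv2 V \<theta> = (\<psi> \<bullet> \<theta>) \<bullet> inv2 V \<theta>"
    by (simp only: assms(1))
  then show ?thesis
    using assms(2-) by simp
qed

lemma vcomp_left_cancel:
  assumes "\<theta> \<bullet> \<phi> = \<theta> \<bullet> \<psi>" "invertible2 V \<theta>" "cod2 V \<phi> = dom2 V \<theta>" "cod2 V \<psi> = dom2 V \<theta>"
  shows "\<phi> = \<psi>"
proof -
  have "inv2 V \<theta> \<bullet> \<theta> \<bullet> \<phi> = inv2 V \<theta> \<bullet> \<theta> \<bullet> \<psi>"
    by (simp only: assms(1))
  then show ?thesis
    using assms(2-) by simp
qed

end


subsection \<open>2-functors\<close>

context two_functor
begin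

lemma dom1_F1 [simp]: "dom1 V (F1 f) = F0 (dom1 V f)"
  and cod1_F1 [simp]: "cod1 V (F1 f) = F0 (cod1 V f)"
  using F1_hom[of f "dom1 V f" "cod1 V f"] by (auto simp: hom1_def)

lemma dom2_F2 [simp]: "dom2 V (F2 \<theta>) = F1 (dom2 V \<theta>)"
  and cod2_F2 [simp]: "cod2 V (F2 \<theta>) = F1 (cod2 V \<theta>)"
  using F2_hom[of \<theta> "dom2 V \<theta>" "cod2 V \<theta>"] by (auto simp: hom2_def)

lemma F1_comp1 [simp]: "cod1 V f = dom1 V g \<Longrightarrow> F1 (g \<cdot> f) = F1 g \<cdot> F1 f"
  using F1_comp by (auto simp: hom1_def)

lemma F2_vcomp' [simp]: "cod2 V \<theta> = dom2 V \<phi> \<Longrightarrow> F2 (\<phi> \<bullet> \<theta>) = F2 \<phi> \<bullet> F2 \<theta>"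
  using F2_vcomp by (auto simp: hom2_def)

lemma F2_hcomp':
  "cod1 V (dom2 V \<theta>) = dom1 V (dom2 V \<phi>) \<Longrightarrow> F2 (\<phi> \<star> \<theta>) = F2 \<phi> \<star> F2 \<theta>"
  using F2_hcomp[of "dom2 V \<theta>" _ _ "dom2 V \<phi>" _ \<theta> "cod2 V \<theta>" \<phi> "cod2 V \<phi>"]
  by (auto simp: hom1_def hom2_def)

lemma F2_whisker_left [simp]: "cod1 V (dom2 V \<theta>) = dom1 V g \<Longrightarrow> F2 (g \<rhd> \<theta>) = F1 g \<rhd> F2 \<theta>"
  by (simp add: whisker_left_def F2_hcomp' F2_id)

lemma F2_whisker_right [simp]: "cod1 V f = dom1 V (dom2 V \<theta>) \<Longrightarrow> F2 (\<theta> \<lhd> f) = F2 \<theta> \<lhd> F1 f"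
  by (simp add: whisker_right_def F2_hcomp' F2_id)

lemma is_inv2_F2:
  assumes "invertible2 V \<theta>"
  shows "is_inv2 V (F2 \<theta>) (F2 (inv2 V \<theta>))"
  using assms by (simp add: is_inv2_def F2_vcomp'[symmetric] F2_id del: F2_vcomp')

lemma invertible2_F2 [simp]: "invertible2 V \<theta> \<Longrightarrow> invertible2 V (F2 \<theta>)"
  by (rule invertible2I[OF is_inv2_F2])

lemma inv2_F2: "invertible2 V \<theta> \<Longrightarrow> inv2 V (F2 \<theta>) = F2 (inv2 V \<theta>)"
  by (rule inv2_eqI[OF is_inv2_F2])

end


section \<open>Calculus in a Gray monoid\<close>

context gray_monoid
begin

lemmas ltensor_simps [simp] =
  two_functor.dom1_F1[OF ltensor_functor] two_functor.cod1_F1[OF ltensor_functor]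
  two_functor.dom2_F2[OF ltensor_functor] two_functor.cod2_F2[OF ltensor_functor]
  two_functor.F1_id[OF ltensor_functor] two_functor.F1_comp1[OF ltensor_functor]
  two_functor.F2_id[OF ltensor_functor] two_functor.F2_vcomp'[OF ltensor_functor]
  two_functor.F2_whisker_left[OF ltensor_functor] two_functor.F2_whisker_right[OF ltensor_functor]
  two_functor.invertible2_F2[OF ltensor_functor]

lemmas rtensor_simps [simp] =
  two_functor.dom1_F1[OF rtensor_functor] two_functor.cod1_F1[OF rtensor_functor]
  two_functor.dom2_F2[OF rtensor_functor] two_functor.cod2_F2[OF rtensor_functor]
  two_functor.F1_id[OF rtensor_functor] two_functor.F1_comp1[OF rtensor_functor]
  two_functor.F2_id[OF rtensor_functor] two_functor.F2_vcomp'[OF rtensor_functor]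
  two_functor.F2_whisker_left[OF rtensor_functor] two_functor.F2_whisker_right[OF rtensor_functor]
  two_functor.invertible2_F2[OF rtensor_functor]

lemmas inv2_ltensor2 = two_functor.inv2_F2[OF ltensor_functor]
lemmas inv2_rtensor2 = two_functor.inv2_F2[OF rtensor_functor]

text \<open>Strict associativity is oriented so that successive tensorings by objects on one side
  merge into one tensor product and \<open>\<ltimes>\<close> stands outside
  \<open>\<rtimes>\<close>. The rules \<open>interchanger_tensor\<close> stay out of the simpset and
  are added where an interchanger must be moved through a tensor product.\<close>

declare tensor_unit_left [simp] tensor_unit_right [simp]
declare tensor_assoc [simp] tensor_assoc1(2) [simp] tensor_assoc2(2) [simp]
declare tensor_assoc1(1,3) [symmetric, simp] tensor_assoc2(1,3) [symmetric, simp]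

lemma dom2_interchanger [simp]: "dom2 V (\<Sigma> f g) = (f \<rtimes> cod1 V g) \<cdot> (dom1 V f \<ltimes> g)"
  and cod2_interchanger [simp]: "cod2 V (\<Sigma> f g) = (cod1 V f \<ltimes> g) \<cdot> (f \<rtimes> dom1 V g)"
  and invertible2_interchanger [simp]: "invertible2 V (\<Sigma> f g)"
  using interchanger_iso[of f "dom1 V f" "cod1 V f" g "dom1 V g" "cod1 V g"]
  by (auto simp: hom1_def hom2_def iso2_def)

lemma interchanger_natural_left:
  assumes "dom2 V \<theta> = f" "cod2 V \<theta> = f'"
  shows "\<Sigma> f' g \<bullet> ((\<theta> \<rtimes>\<^sub>2 cod1 V g) \<lhd> (dom1 V f \<ltimes> g))
    = ((cod1 V f \<ltimes> g) \<rhd> (\<theta> \<rtimes>\<^sub>2 dom1 V g)) \<bullet> \<Sigma> f g"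
  using assms interchanger_natural[of f "dom1 V f" "cod1 V f" g "dom1 V g" "cod1 V g" \<theta> f' "\<i> g" g]
  by (simp add: hom1_def hom2_def whisker_left_def whisker_right_def)

lemma interchanger_natural_right:
  assumes "dom2 V \<phi> = g" "cod2 V \<phi> = g'"
  shows "\<Sigma> f g' \<bullet> ((f \<rtimes> cod1 V g) \<rhd> (dom1 V f \<ltimes>\<^sub>2 \<phi>))
    = ((cod1 V f \<ltimes>\<^sub>2 \<phi>) \<lhd> (f \<rtimes> dom1 V g)) \<bullet> \<Sigma> f g"
  using assms interchanger_natural[of f "dom1 V f" "cod1 V f" g "dom1 V g" "cod1 V g" "\<i> f" f \<phi> g']
  by (simp add: hom1_def hom2_def whisker_left_def whisker_right_def)

lemma interchanger_comp1_left:
  "cod1 V f = dom1 V f' \<Longrightarrow>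
    \<Sigma> (f' \<cdot> f) g = (\<Sigma> f' g \<lhd> (f \<rtimes> dom1 V g)) \<bullet> ((f' \<rtimes> cod1 V g) \<rhd> \<Sigma> f g)"
  using interchanger_comp_left by (auto simp: hom1_def)

lemma interchanger_comp1_right:
  "cod1 V g = dom1 V g' \<Longrightarrow>
    \<Sigma> f (g' \<cdot> g) = ((cod1 V f \<ltimes> g') \<rhd> \<Sigma> f g) \<bullet> (\<Sigma> f g' \<lhd> (dom1 V f \<ltimes> g))"
  using interchanger_comp_right by (auto simp: hom1_def)

lemma interchanger_id1_left [simp]: "\<Sigma> (\<one> A) g = \<i> (A \<ltimes> g)"
  using interchanger_id_left by (auto simp: hom1_def)

end


section \<open>Transposition along the tensor-hom adjunction\<close>

lemma (in pseudofunctor) pf_comp_natural_left: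
  assumes "cod1 V (dom2 V \<theta>) = dom1 V g" "dom2 V \<theta> = f" "cod2 V \<theta> = f'"
  shows "pf_comp F g f' \<bullet> (pf1 F g \<rhd> pf2 F \<theta>) = pf2 F (g \<rhd> \<theta>) \<bullet> pf_comp F g f"
  using assms pf_comp_natural[of f "dom1 V f" "cod1 V f" g "cod1 V g" \<theta> f' "\<i> g" g]
  by (simp add: hom1_def hom2_def whisker_left_def pf2_id)

context right_closed_gray_monoid
begin

section \<open>The internal hom as a pseudofunctor\<close>

lemma ihom_pseudofunctor: "pseudofunctor V (ihom V a)"
  using tensor_hom_adjunction[of a] by (simp add: pseudoadjunction_def)

lemma dom1_ihom1 [simp]: "dom1 V (pf1 (ihom V a) f) = hm V a (dom1 V f)"
  and cod1_ihom1 [simp]: "cod1 V (pf1 (ihom V a) f) = hm V a (cod1 V f)"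
  using pseudofunctor.pf1_hom[OF ihom_pseudofunctor, of f "dom1 V f" "cod1 V f" a]
  by (auto simp: hom1_def hm_def)

lemma dom2_ihom2 [simp]: "dom2 V (pf2 (ihom V a) \<theta>) = pf1 (ihom V a) (dom2 V \<theta>)"
  and cod2_ihom2 [simp]: "cod2 V (pf2 (ihom V a) \<theta>) = pf1 (ihom V a) (cod2 V \<theta>)"
  using pseudofunctor.pf2_hom[OF ihom_pseudofunctor, of \<theta> "dom2 V \<theta>" "cod2 V \<theta>" a]
  by (auto simp: hom2_def)

lemma ihom2_vcomp:
  "cod2 V \<theta> = dom2 V \<phi> \<Longrightarrow>
    pf2 (ihom V a) (\<phi> \<bullet> \<theta>) = pf2 (ihom V a) \<phi> \<bullet> pf2 (ihom V a) \<theta>"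
  using pseudofunctor.pf2_vcomp[OF ihom_pseudofunctor, of \<theta> "dom2 V \<theta>" "dom2 V \<phi>"]
  by (simp add: hom2_def)

lemma ihom2_id2: "pf2 (ihom V a) (\<i> f) = \<i> (pf1 (ihom V a) f)"
  by (rule pseudofunctor.pf2_id[OF ihom_pseudofunctor])

lemma is_inv2_ihom2:
  assumes "invertible2 V \<theta>"
  shows "is_inv2 V (pf2 (ihom V a) \<theta>) (pf2 (ihom V a) (inv2 V \<theta>))"
  using assms by (simp add: is_inv2_def ihom2_vcomp[symmetric] ihom2_id2)

lemma invertible2_ihom2 [simp]: "invertible2 V \<theta> \<Longrightarrow> invertible2 V (pf2 (ihom V a) \<theta>)"
  by (rule invertible2I[OF is_inv2_ihom2])

lemma
  assumes "cod1 V f = dom1 V g"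
  shows dom2_ihom_comp [simp]:
      "dom2 V (pf_comp (ihom V a) g f) = pf1 (ihom V a) g \<cdot> pf1 (ihom V a) f"
    and cod2_ihom_comp [simp]: "cod2 V (pf_comp (ihom V a) g f) = pf1 (ihom V a) (g \<cdot> f)"
    and invertible2_ihom_comp [simp]: "invertible2 V (pf_comp (ihom V a) g f)"
  using assms pseudofunctor.pf_comp_iso[OF ihom_pseudofunctor, of f "dom1 V f" "dom1 V g" g "cod1 V g" a]
  by (auto simp: hom1_def hom2_def iso2_def)

lemma dom2_ihom_unit [simp]: "dom2 V (pf_unit (ihom V a) B) = \<one> (hm V a B)"
  and cod2_ihom_unit [simp]: "cod2 V (pf_unit (ihom V a) B) = pf1 (ihom V a) (\<one> B)"
  and invertible2_ihom_unit [simp]: "invertible2 V (pf_unit (ihom V a) B)"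
  using pseudofunctor.pf_unit_iso[OF ihom_pseudofunctor, of a B]
  by (auto simp: hom2_def iso2_def hm_def)

lemma
  assumes "cod1 V f = dom1 V g" "cod1 V h = dom1 V k" "dom2 V \<theta> = g \<cdot> f" "cod2 V \<theta> = k \<cdot> h"
  shows dom2_ihom_square [simp]:
      "dom2 V (pf_square V (ihom V a) g f \<theta> k h) = pf1 (ihom V a) g \<cdot> pf1 (ihom V a) f"
    and cod2_ihom_square [simp]:
      "cod2 V (pf_square V (ihom V a) g f \<theta> k h) = pf1 (ihom V a) k \<cdot> pf1 (ihom V a) h"
    and invertible2_ihom_square [simp]:
      "invertible2 V \<theta> \<Longrightarrow> invertible2 V (pf_square V (ihom V a) g f \<theta> k h)"
  using assms by (simp_all add: pf_square_def)

lemma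
  assumes "cod1 V f = dom1 V g" "dom2 V \<theta> = g \<cdot> f" "cod2 V \<theta> = \<one> A"
  shows dom2_ihom_triangle [simp]:
      "dom2 V (pf_triangle V (ihom V a) g f \<theta> A) = pf1 (ihom V a) g \<cdot> pf1 (ihom V a) f"
    and cod2_ihom_triangle [simp]: "cod2 V (pf_triangle V (ihom V a) g f \<theta> A) = \<one> (hm V a A)"
    and invertible2_ihom_triangle [simp]:
      "invertible2 V \<theta> \<Longrightarrow> invertible2 V (pf_triangle V (ihom V a) g f \<theta> A)"
  using assms by (simp_all add: pf_triangle_def)

section \<open>Unit and counit of the tensor-hom adjunction\<close>

lemma dom1_coev [simp]: "dom1 V (pn1 (coev V a) B) = B"
  and cod1_coev [simp]: "cod1 V (pn1 (coev V a) B) = hm V a (B \<otimes> a)"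
  using pseudonatural.pn1_hom[OF pseudoadjunction.unit[OF tensor_hom_adjunction], of a B]
  by (auto simp: hom1_def pf_id_def pf_compose_def rtensor_pf_def hm_def)

lemma dom2_coev2 [simp]:
    "dom2 V (pn2 (coev V a) f) = pf1 (ihom V a) (f \<rtimes> a) \<cdot> pn1 (coev V a) (dom1 V f)"
  and cod2_coev2 [simp]: "cod2 V (pn2 (coev V a) f) = pn1 (coev V a) (cod1 V f) \<cdot> f"
  and invertible2_coev2 [simp]: "invertible2 V (pn2 (coev V a) f)"
  using pseudonatural.pn2_iso[OF pseudoadjunction.unit[OF tensor_hom_adjunction],
      of f "dom1 V f" "cod1 V f" a]
  by (auto simp: hom1_def hom2_def iso2_def pf_id_def pf_compose_def rtensor_pf_def)

lemma coev2_natural: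
  assumes "dom2 V \<theta> = f" "cod2 V \<theta> = g"
  shows "pn2 (coev V a) g \<bullet> (pf2 (ihom V a) (\<theta> \<rtimes>\<^sub>2 a) \<lhd> pn1 (coev V a) (dom1 V f))
    = (pn1 (coev V a) (cod1 V f) \<rhd> \<theta>) \<bullet> pn2 (coev V a) f"
  using assms pseudonatural.pn2_natural[OF pseudoadjunction.unit[OF tensor_hom_adjunction],
      of f "dom1 V f" "cod1 V f" \<theta> g a]
  by (simp add: hom1_def hom2_def pf_id_def pf_compose_def rtensor_pf_def)

lemma dom1_ev [simp]: "dom1 V (ev V a B) = hm V a B \<otimes> a"
  and cod1_ev [simp]: "cod1 V (ev V a B) = B"
  using pseudonatural.pn1_hom[OF pseudoadjunction.counit[OF tensor_hom_adjunction], of a B]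
  by (auto simp: hom1_def pf_id_def pf_compose_def rtensor_pf_def hm_def ev_def)

lemma dom2_eval2 [simp]: "dom2 V (pn2 (eval V a) f) = f \<cdot> ev V a (dom1 V f)"
  and cod2_eval2 [simp]:
    "cod2 V (pn2 (eval V a) f) = ev V a (cod1 V f) \<cdot> (pf1 (ihom V a) f \<rtimes> a)"
  and invertible2_eval2 [simp]: "invertible2 V (pn2 (eval V a) f)"
  using pseudonatural.pn2_iso[OF pseudoadjunction.counit[OF tensor_hom_adjunction],
      of f "dom1 V f" "cod1 V f" a]
  by (auto simp: hom1_def hom2_def iso2_def pf_id_def pf_compose_def rtensor_pf_def ev_def)

lemma eval2_natural:
  assumes "dom2 V \<theta> = f" "cod2 V \<theta> = g"
  shows "pn2 (eval V a) g \<bullet> (\<theta> \<lhd> ev V a (dom1 V f))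
    = (ev V a (cod1 V f) \<rhd> (pf2 (ihom V a) \<theta> \<rtimes>\<^sub>2 a)) \<bullet> pn2 (eval V a) f"
  using assms pseudonatural.pn2_natural[OF pseudoadjunction.counit[OF tensor_hom_adjunction],
      of f "dom1 V f" "cod1 V f" \<theta> g a]
  by (simp add: hom1_def hom2_def pf_id_def pf_compose_def rtensor_pf_def ev_def)

lemma eval2_comp1:
  assumes "cod1 V f = dom1 V g"
  shows "pn2 (eval V a) (g \<cdot> f)
    = (ev V a (cod1 V g) \<rhd> (pf_comp (ihom V a) g f \<rtimes>\<^sub>2 a))
      \<bullet> (pn2 (eval V a) g \<lhd> (pf1 (ihom V a) f \<rtimes> a)) \<bullet> (g \<rhd> pn2 (eval V a) f)"
  using assms pseudonatural.pn2_comp[OF pseudoadjunction.counit[OF tensor_hom_adjunction],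
      of f "dom1 V f" "cod1 V f" g "cod1 V g" a]
  by (simp add: hom1_def pf_id_def pf_compose_def rtensor_pf_def ev_def[symmetric])

lemma eval2_id1:
  "pn2 (eval V a) (\<one> A) = ev V a A \<rhd> (pf_unit (ihom V a) A \<rtimes>\<^sub>2 a)"
  using pseudonatural.pn2_unit[OF pseudoadjunction.counit[OF tensor_hom_adjunction], of a A]
  by (simp add: pf_id_def pf_compose_def rtensor_pf_def ev_def[symmetric] hm_def[symmetric])

section \<open>The triangulators and faithfulness of transposition\<close>

lemma dom2_tri_s [simp]: "dom2 V (tri_s V a B) = \<one> (B \<otimes> a)"
  and cod2_tri_s [simp]: "cod2 V (tri_s V a B) = ev V a (B \<otimes> a) \<cdot> (pn1 (coev V a) B \<rtimes> a)"
  using modification.mod_hom[OF pseudoadjunction.s_mod[OF tensor_hom_adjunction], of a B]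
  by (auto simp: hom2_def pn_id_def pn_compose_def pn_precomp_def pn_postcomp_def rtensor_pf_def
      ev_def)

lemma invertible2_tri_s [simp]: "invertible2 V (tri_s V a B)"
  by (rule pseudoadjunction.s_inv[OF tensor_hom_adjunction])

text \<open>The modification axiom for \<open>s\<close> unfolded. Its source is an identity
  transformation, whose cell vanishes on the left, and \<open>- \<otimes> a\<close> is a strict
  2-functor, so the \<open>pf_square\<close> in the target carries no coherence cells.\<close>

lemma tri_s_natural:
  "tri_s V a (cod1 V f) \<lhd> (f \<rtimes> a)
    = (ev V a (cod1 V f \<otimes> a) \<rhd> (pn2 (coev V a) f \<rtimes>\<^sub>2 a))
      \<bullet> (pn2 (eval V a) (f \<rtimes> a) \<lhd> (pn1 (coev V a) (dom1 V f) \<rtimes> a))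
      \<bullet> ((f \<rtimes> a) \<rhd> tri_s V a (dom1 V f))"
  using modification.mod_natural[OF pseudoadjunction.s_mod[OF tensor_hom_adjunction],
      of f "dom1 V f" "cod1 V f" a]
  by (simp add: hom1_def pn_id_def pn_compose_def pn_precomp_def pn_postcomp_def rtensor_pf_def
      pf_square_def pf_compose_def pf_id_def ev_def[symmetric])

lemma dom2_tri_t [simp]:
    "dom2 V (tri_t V a B) = pf1 (ihom V a) (ev V a B) \<cdot> pn1 (coev V a) (hm V a B)"
  and cod2_tri_t [simp]: "cod2 V (tri_t V a B) = \<one> (hm V a B)"
  using modification.mod_hom[OF pseudoadjunction.t_mod[OF tensor_hom_adjunction], of a B]
  by (auto simp: hom2_def pn_id_def pn_compose_def pn_precomp_def pn_postcomp_def
      ev_def hm_def)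

lemma invertible2_tri_t [simp]: "invertible2 V (tri_t V a B)"
  by (rule pseudoadjunction.t_inv[OF tensor_hom_adjunction])

text \<open>This is the swallowtail equation for the counit; strictness of
  \<open>- \<otimes> a\<close> reduces the \<open>pf_triangle\<close> in it to
  \<open>tri_t V a B \<rtimes>\<^sub>2 a\<close>.\<close>

lemma tri_t_swallowtail:
  "(ev V a B \<rhd> (tri_t V a B \<rtimes>\<^sub>2 a))
    \<bullet> (pn2 (eval V a) (ev V a B) \<lhd> (pn1 (coev V a) (hm V a B) \<rtimes> a))
    \<bullet> (ev V a B \<rhd> tri_s V a (hm V a B)) = \<i> (ev V a B)"
  using pseudoadjunction.swallowtail_counit[OF tensor_hom_adjunction, of a B]
  by (simp add: rtensor_pf_def pf_triangle_def ev_def[symmetric] hm_def[symmetric])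

text \<open>Since \<open>f\<close> is recovered up to \<open>t\<close> as the transpose of \<open>\<epsilon>(f1)\<close>, so is every 2-cell.\<close>

lemma ev_faithful:
  assumes "ev V a B \<rhd> (\<theta> \<rtimes>\<^sub>2 a) = ev V a B \<rhd> (\<phi> \<rtimes>\<^sub>2 a)"
    and "dom2 V \<theta> = dom2 V \<phi>" "cod2 V \<theta> = cod2 V \<phi>" "cod1 V (dom2 V \<phi>) = hm V a B"
  shows "\<theta> = \<phi>"
proof -
  define f g where "f = dom2 V \<phi>" and "g = cod2 V \<phi>"
  with assms(2-4) have cells [simp]: "dom2 V \<theta> = f" "cod2 V \<theta> = g" "dom2 V \<phi> = f" "cod2 V \<phi> = g"
    "cod1 V f = hm V a B"
    by simp_all
  let ?G = "pf1 (ihom V a)" and ?\<eta> = "\<lambda>B. pn1 (coev V a) B" and ?\<epsilon> = "ev V a B"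
  have [simp]: "dom1 V g = dom1 V f" "cod1 V g = hm V a B"
    using dom1_cod2[of \<theta>] cod1_cod2[of \<theta>] by simp_all
  \<comment> \<open>The hypothesis concerns the image under \<open>[a,-]\<close> of a whiskered
    cell. Naturality of the compositor turns this image into a whiskering of \<open>pf2\<close>, up
    to invertible cells.\<close>
  have "pf_comp (ihom V a) ?\<epsilon> (g \<rtimes> a) \<bullet> (?G ?\<epsilon> \<rhd> pf2 (ihom V a) (\<theta> \<rtimes>\<^sub>2 a))
      = pf_comp (ihom V a) ?\<epsilon> (g \<rtimes> a) \<bullet> (?G ?\<epsilon> \<rhd> pf2 (ihom V a) (\<phi> \<rtimes>\<^sub>2 a))"
    by (simp add: pseudofunctor.pf_comp_natural_left[OF ihom_pseudofunctor, where f = "f \<rtimes> a"]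
        assms(1))
  then have *: "?G ?\<epsilon> \<rhd> pf2 (ihom V a) (\<theta> \<rtimes>\<^sub>2 a) = ?G ?\<epsilon> \<rhd> pf2 (ihom V a) (\<phi> \<rtimes>\<^sub>2 a)"
    by (rule vcomp_left_cancel) simp_all
  \<comment> \<open>Pseudonaturality of \<eta> trades \<open>[a, \<psi> \<rtimes>\<^sub>2 a]\<close>
    after the unit for \<open>\<psi>\<close> before it.\<close>
  have natural: "((?G ?\<epsilon> \<cdot> ?\<eta> (hm V a B)) \<rhd> \<psi>) \<bullet> (?G ?\<epsilon> \<rhd> pn2 (coev V a) f)
      = (?G ?\<epsilon> \<rhd> pn2 (coev V a) g) \<bullet> (?G ?\<epsilon> \<rhd> pf2 (ihom V a) (\<psi> \<rtimes>\<^sub>2 a)) \<lhd> ?\<eta> (dom1 V f)"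
    if [simp]: "dom2 V \<psi> = f" "cod2 V \<psi> = g" for \<psi>
    using arg_cong[OF coev2_natural[of \<psi> f g a], of "\<lambda>\<xi>. ?G ?\<epsilon> \<rhd> \<xi>"] by simp
  have "((?G ?\<epsilon> \<cdot> ?\<eta> (hm V a B)) \<rhd> \<theta>) \<bullet> (?G ?\<epsilon> \<rhd> pn2 (coev V a) f)
      = ((?G ?\<epsilon> \<cdot> ?\<eta> (hm V a B)) \<rhd> \<phi>) \<bullet> (?G ?\<epsilon> \<rhd> pn2 (coev V a) f)"
    unfolding natural[OF cells(1,2)] natural[OF cells(3,4)] * ..
  then have **: "(?G ?\<epsilon> \<cdot> ?\<eta> (hm V a B)) \<rhd> \<theta> = (?G ?\<epsilon> \<cdot> ?\<eta> (hm V a B)) \<rhd> \<phi>"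
    by (rule vcomp_right_cancel) simp_all
  \<comment> \<open>Exchange with the invertible cell \<open>t\<close> strips the remaining
    whiskering by \<open>[1,\<epsilon>]\<eta>\<close> and recovers the 2-cell itself.\<close>
  have "\<psi> \<bullet> (tri_t V a B \<lhd> f) = (tri_t V a B \<lhd> g) \<bullet> ((?G ?\<epsilon> \<cdot> ?\<eta> (hm V a B)) \<rhd> \<psi>)"
    if [simp]: "dom2 V \<psi> = f" "cod2 V \<psi> = g" for \<psi>
    using whisker_exchange[of \<psi> "tri_t V a B"] by simp
  then have "\<theta> \<bullet> (tri_t V a B \<lhd> f) = \<phi> \<bullet> (tri_t V a B \<lhd> f)"
    by (simp add: **)
  then show ?thesis
    by (rule vcomp_right_cancel) simp_all
qed

text \<open>
  Let \<open>\<delta> : k \<Rightarrow> \<epsilon>(h1)\<close>, so that \<open>h\<close> is, up to isomorphism, the transpose of \<open>k\<close>.  Then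
  \<open>transpose_post g h a \<delta> : gk \<Rightarrow> \<epsilon>([1,g]1)(h1)\<close> exhibits \<open>[1,g]h\<close> as the transpose of \<open>gk\<close>.
\<close>

definition transpose_post :: "'a \<Rightarrow> 'a \<Rightarrow> 'o \<Rightarrow> 't \<Rightarrow> 't" where
  "transpose_post g h a \<delta> = (pn2 (eval V a) g \<lhd> (h \<rtimes> a)) \<bullet> (g \<rhd> \<delta>)"

text \<open>
  \<open>is_mate a B \<theta> \<delta> \<delta>' \<omega>\<close>: under transposition along \<open>\<delta>\<close> and \<open>\<delta>'\<close>, the 2-cell \<open>\<theta>\<close> between
  1-cells into \<open>[a,B]\<close> corresponds to the 2-cell \<open>\<omega>\<close> between 1-cells into \<open>B\<close>.
\<close>

definition is_mate :: "'o \<Rightarrow> 'o \<Rightarrow> 't \<Rightarrow> 't \<Rightarrow> 't \<Rightarrow> 't \<Rightarrow> bool" where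
  "is_mate a B \<theta> \<delta> \<delta>' \<omega> \<longleftrightarrow>
    cod1 V (dom2 V \<theta>) = hm V a B \<and>
    cod2 V \<delta> = ev V a B \<cdot> (dom2 V \<theta> \<rtimes> a) \<and> cod2 V \<delta>' = ev V a B \<cdot> (cod2 V \<theta> \<rtimes> a) \<and>
    dom2 V \<omega> = dom2 V \<delta> \<and> cod2 V \<omega> = dom2 V \<delta>' \<and>
    (ev V a B \<rhd> (\<theta> \<rtimes>\<^sub>2 a)) \<bullet> \<delta> = \<delta>' \<bullet> \<omega>"

section \<open>Calculus of mates\<close>

lemma cod_transposed:
  assumes "cod2 V \<delta> = ev V a B \<cdot> (h \<rtimes> a)" "cod1 V h = hm V a B"
  shows "cod1 V (dom2 V \<delta>) = B" "dom1 V (dom2 V \<delta>) = dom1 V h \<otimes> a"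
  using assms cod1_cod2[of \<delta>] dom1_cod2[of \<delta>] by simp_all

lemma
  assumes "cod2 V \<delta> = ev V a (dom1 V g) \<cdot> (h \<rtimes> a)" "cod1 V h = hm V a (dom1 V g)"
  shows dom2_transpose_post [simp]: "dom2 V (transpose_post g h a \<delta>) = g \<cdot> dom2 V \<delta>"
    and cod2_transpose_post [simp]: "cod2 V (transpose_post g h a \<delta>)
      = ev V a (cod1 V g) \<cdot> (pf1 (ihom V a) g \<rtimes> a) \<cdot> (h \<rtimes> a)"
    and invertible2_transpose_post [simp]:
      "invertible2 V \<delta> \<Longrightarrow> invertible2 V (transpose_post g h a \<delta>)"
  using assms cod_transposed[OF assms] by (simp_all add: transpose_post_def)

lemma transpose_post_whisker_right:
  assumes "cod2 V \<delta> = ev V a (dom1 V g) \<cdot> (h \<rtimes> a)" "cod1 V h = hm V a (dom1 V g)"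
    and "cod1 V x = dom1 V h"
  shows "transpose_post g h a \<delta> \<lhd> (x \<rtimes> a) = transpose_post g (h \<cdot> x) a (\<delta> \<lhd> (x \<rtimes> a))"
  using assms cod_transposed[OF assms(1,2)] by (simp add: transpose_post_def)

lemma is_mate_vcomp:
  assumes "is_mate a B \<theta> \<delta> \<delta>' \<omega>" "is_mate a B \<theta>' \<delta>' \<delta>'' \<omega>'" "cod2 V \<theta> = dom2 V \<theta>'"
  shows "is_mate a B (\<theta>' \<bullet> \<theta>) \<delta> \<delta>'' (\<omega>' \<bullet> \<omega>)"
proof -
  let ?E = "\<lambda>\<theta>. ev V a B \<rhd> (\<theta> \<rtimes>\<^sub>2 a)"
  note [simp] = assms(3) and m = assms(1,2)[unfolded is_mate_def]
  have [simp]: "cod1 V (dom2 V \<theta>') = hm V a B"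
    using m by simp
  have "?E (\<theta>' \<bullet> \<theta>) \<bullet> \<delta> = ?E \<theta>' \<bullet> ?E \<theta> \<bullet> \<delta>"
    using m by simp
  also have "?E \<theta> \<bullet> \<delta> = \<delta>' \<bullet> \<omega>"
    using m by simp
  also have "?E \<theta>' \<bullet> \<delta>' \<bullet> \<omega> = (?E \<theta>' \<bullet> \<delta>') \<bullet> \<omega>"
    by (rule vcomp_assoc'[symmetric]) (use m in simp_all)
  also have "?E \<theta>' \<bullet> \<delta>' = \<delta>'' \<bullet> \<omega>'"
    using m by simp
  also have "(\<delta>'' \<bullet> \<omega>') \<bullet> \<omega> = \<delta>'' \<bullet> \<omega>' \<bullet> \<omega>"
    using m by simp
  finally show ?thesis
    using m by (simp add: is_mate_def)
qed

text \<open>Needed because each of \<alpha>, \<lambda> and \<rho> starts with the inverse of a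
  pseudonaturality cell of \<eta>.\<close>

lemma is_mate_inv2:
  assumes "is_mate a B \<theta> \<delta> \<delta>' \<omega>" "invertible2 V \<theta>" "invertible2 V \<omega>"
  shows "is_mate a B (inv2 V \<theta>) \<delta>' \<delta> (inv2 V \<omega>)"
proof -
  let ?E = "\<lambda>\<theta>. ev V a B \<rhd> (\<theta> \<rtimes>\<^sub>2 a)"
  note m = assms(1)[unfolded is_mate_def] and [simp] = assms(2,3)
  have typing: "cod1 V (dom2 V \<theta>) = hm V a B" "cod2 V \<delta> = ev V a B \<cdot> (dom2 V \<theta> \<rtimes> a)"
    "dom2 V \<omega> = dom2 V \<delta>"
    using m by simp_all
  have inv: "?E (inv2 V \<theta>) \<bullet> ?E \<theta> = \<i> (ev V a B \<cdot> (dom2 V \<theta> \<rtimes> a))"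
    using m by (simp add: inv2_rtensor2[symmetric] inv2_whisker_left[symmetric])
  have "?E (inv2 V \<theta>) \<bullet> \<delta>' = ?E (inv2 V \<theta>) \<bullet> (\<delta>' \<bullet> \<omega>) \<bullet> inv2 V \<omega>"
    using m by simp
  also have "\<delta>' \<bullet> \<omega> = ?E \<theta> \<bullet> \<delta>"
    using m by simp
  also have "?E (inv2 V \<theta>) \<bullet> (?E \<theta> \<bullet> \<delta>) \<bullet> inv2 V \<omega>
      = (?E (inv2 V \<theta>) \<bullet> ?E \<theta>) \<bullet> \<delta> \<bullet> inv2 V \<omega>"
    by (simp add: typing)
  also have "\<dots> = \<delta> \<bullet> inv2 V \<omega>"
    unfolding inv using m by simp
  finally show ?thesis
    using m by (simp add: is_mate_def)
qed

text \<open>The cell \<open>\<theta>\<close> and the pseudonaturality cell of \<epsilon> at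
  \<open>g\<close> sit on different factors, so they exchange; after that the mate equation of
  \<open>\<theta>\<close> is whiskered by \<open>g\<close>.\<close>

lemma is_mate_post:
  assumes "is_mate a (dom1 V g) \<theta> \<delta> \<delta>' \<omega>" "dom2 V \<theta> = h" "cod2 V \<theta> = h'"
  shows "is_mate a (cod1 V g) (pf1 (ihom V a) g \<rhd> \<theta>)
    (transpose_post g h a \<delta>) (transpose_post g h' a \<delta>') (g \<rhd> \<omega>)"
proof -
  note m = assms(1)[unfolded is_mate_def] and [simp] = assms(2,3)
  let ?G = "pf1 (ihom V a) g"
  have [simp]: "cod1 V h' = hm V a (dom1 V g)" "cod1 V (dom2 V \<delta>) = dom1 V g"
    "dom1 V (dom2 V \<delta>) = dom1 V h \<otimes> a" "dom1 V h' = dom1 V h"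
    "cod1 V (dom2 V \<delta>') = dom1 V g"
    using m cod_transposed[of \<delta> a "dom1 V g" h] cod1_cod2[of \<theta>] dom1_cod2[of \<theta>]
      cod_transposed[of \<delta>' a "dom1 V g" h'] by simp_all
  have "(ev V a (cod1 V g) \<rhd> ((?G \<rhd> \<theta>) \<rtimes>\<^sub>2 a)) \<bullet> transpose_post g h a \<delta>
      = ((ev V a (cod1 V g) \<cdot> (?G \<rtimes> a)) \<rhd> (\<theta> \<rtimes>\<^sub>2 a))
        \<bullet> (pn2 (eval V a) g \<lhd> (h \<rtimes> a)) \<bullet> (g \<rhd> \<delta>)"
    using m by (simp add: transpose_post_def)
  also have "\<dots> = (pn2 (eval V a) g \<lhd> (h' \<rtimes> a))
        \<bullet> ((g \<cdot> ev V a (dom1 V g)) \<rhd> (\<theta> \<rtimes>\<^sub>2 a)) \<bullet> (g \<rhd> \<delta>)"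
    using m by (intro vcomp_left_cong whisker_exchange[symmetric]) simp_all
  also have "\<dots> = (pn2 (eval V a) g \<lhd> (h' \<rtimes> a))
        \<bullet> (g \<rhd> ((ev V a (dom1 V g) \<rhd> (\<theta> \<rtimes>\<^sub>2 a)) \<bullet> \<delta>))"
    by (subst whisker_left_vcomp) (use m in simp_all)
  also have "(ev V a (dom1 V g) \<rhd> (\<theta> \<rtimes>\<^sub>2 a)) \<bullet> \<delta> = \<delta>' \<bullet> \<omega>"
    using m by simp
  also have "(pn2 (eval V a) g \<lhd> (h' \<rtimes> a)) \<bullet> (g \<rhd> (\<delta>' \<bullet> \<omega>))
      = transpose_post g h' a \<delta>' \<bullet> (g \<rhd> \<omega>)"
    using m by (simp add: transpose_post_def)
  finally show ?thesis
    using m by (simp add: is_mate_def)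
qed

text \<open>Here the coherence cells of \<open>[a,-]\<close> disappear. Pseudonaturality of
  \<epsilon> at \<open>g \<cdot> f\<close> absorbs the compositor at the source of
  \<open>pf_square\<close>, naturality moves \<open>\<theta>\<close> across, and the compositor
  produced at \<open>k \<cdot> l\<close> cancels the inverse one at the target.\<close>

lemma eval2_square:
  assumes "cod1 V f = dom1 V g" "cod1 V l = dom1 V k" "dom2 V \<theta> = g \<cdot> f" "cod2 V \<theta> = k \<cdot> l"
  shows "(ev V a (cod1 V k) \<rhd> (pf_square V (ihom V a) g f \<theta> k l \<rtimes>\<^sub>2 a))
      \<bullet> (pn2 (eval V a) g \<lhd> (pf1 (ihom V a) f \<rtimes> a)) \<bullet> (g \<rhd> pn2 (eval V a) f)
    = (pn2 (eval V a) k \<lhd> (pf1 (ihom V a) l \<rtimes> a)) \<bullet> (k \<rhd> pn2 (eval V a) l)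
      \<bullet> (\<theta> \<lhd> ev V a (dom1 V f))"
proof -
  note [simp] = assms
  have [simp]: "cod1 V g = cod1 V k" "dom1 V l = dom1 V f"
    using dom1_cod2[of \<theta>] cod1_cod2[of \<theta>] by simp_all
  let ?G = "ihom V a"
  let ?E = "\<lambda>\<theta>. ev V a (cod1 V k) \<rhd> (\<theta> \<rtimes>\<^sub>2 a)"
  have inv: "?E (inv2 V (pf_comp ?G k l)) \<bullet> ?E (pf_comp ?G k l)
      = \<i> (ev V a (cod1 V k) \<cdot> (pf1 ?G k \<rtimes> a) \<cdot> (pf1 ?G l \<rtimes> a))"
    by (simp add: inv2_rtensor2[symmetric] inv2_whisker_left[symmetric])
  have "?E (pf_square V ?G g f \<theta> k l)
      \<bullet> (pn2 (eval V a) g \<lhd> (pf1 ?G f \<rtimes> a)) \<bullet> (g \<rhd> pn2 (eval V a) f)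
    = ?E (inv2 V (pf_comp ?G k l)) \<bullet> ?E (pf2 ?G \<theta>) \<bullet> pn2 (eval V a) (g \<cdot> f)"
    by (simp add: pf_square_def eval2_comp1)
  also have "\<dots> = ?E (inv2 V (pf_comp ?G k l)) \<bullet> pn2 (eval V a) (k \<cdot> l) \<bullet> (\<theta> \<lhd> ev V a (dom1 V f))"
    using eval2_natural[of \<theta> "g \<cdot> f" "k \<cdot> l" a] by simp
  also have "\<dots> = (?E (inv2 V (pf_comp ?G k l)) \<bullet> ?E (pf_comp ?G k l))
      \<bullet> (pn2 (eval V a) k \<lhd> (pf1 ?G l \<rtimes> a)) \<bullet> (k \<rhd> pn2 (eval V a) l) \<bullet> (\<theta> \<lhd> ev V a (dom1 V f))"
    by (simp add: eval2_comp1)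
  also have "\<dots> = (pn2 (eval V a) k \<lhd> (pf1 ?G l \<rtimes> a)) \<bullet> (k \<rhd> pn2 (eval V a) l)
      \<bullet> (\<theta> \<lhd> ev V a (dom1 V f))"
    unfolding inv by simp
  finally show ?thesis .
qed

text \<open>The argument of \<open>eval2_square\<close> with an identity as target: by
  \<open>eval2_id1\<close> the pseudonaturality cell of \<epsilon> at an identity is the unit
  coherence cell, which cancels the inverse one in \<open>pf_triangle\<close>.\<close>

lemma eval2_triangle:
  assumes "cod1 V f = dom1 V g" "dom2 V \<theta> = g \<cdot> f" "cod2 V \<theta> = \<one> B"
  shows "(ev V a B \<rhd> (pf_triangle V (ihom V a) g f \<theta> B \<rtimes>\<^sub>2 a))
      \<bullet> (pn2 (eval V a) g \<lhd> (pf1 (ihom V a) f \<rtimes> a)) \<bullet> (g \<rhd> pn2 (eval V a) f)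
    = \<theta> \<lhd> ev V a B"
proof -
  note [simp] = assms
  have [simp]: "cod1 V g = B" "dom1 V f = B"
    using dom1_cod2[of \<theta>] cod1_cod2[of \<theta>] by simp_all
  let ?G = "ihom V a"
  let ?E = "\<lambda>\<theta>. ev V a B \<rhd> (\<theta> \<rtimes>\<^sub>2 a)"
  have inv: "?E (inv2 V (pf_unit ?G B)) \<bullet> ?E (pf_unit ?G B) = \<i> (ev V a B)"
    by (simp add: inv2_rtensor2[symmetric] inv2_whisker_left[symmetric])
  have "?E (pf_triangle V ?G g f \<theta> B)
      \<bullet> (pn2 (eval V a) g \<lhd> (pf1 ?G f \<rtimes> a)) \<bullet> (g \<rhd> pn2 (eval V a) f)
    = ?E (inv2 V (pf_unit ?G B)) \<bullet> ?E (pf2 ?G \<theta>) \<bullet> pn2 (eval V a) (g \<cdot> f)"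
    by (simp add: pf_triangle_def eval2_comp1)
  also have "\<dots> = ?E (inv2 V (pf_unit ?G B)) \<bullet> pn2 (eval V a) (\<one> B) \<bullet> (\<theta> \<lhd> ev V a B)"
    using eval2_natural[of \<theta> "g \<cdot> f" "\<one> B" a] by simp
  also have "\<dots> = (?E (inv2 V (pf_unit ?G B)) \<bullet> ?E (pf_unit ?G B)) \<bullet> (\<theta> \<lhd> ev V a B)"
    by (simp add: eval2_id1)
  also have "\<dots> = \<theta> \<lhd> ev V a B"
    unfolding inv by simp
  finally show ?thesis .
qed

lemma transpose_post_twice:
  assumes "cod1 V f = dom1 V g" "cod2 V \<delta> = ev V a (dom1 V f) \<cdot> (h \<rtimes> a)"
    "cod1 V h = hm V a (dom1 V f)"
  shows "transpose_post g (pf1 (ihom V a) f \<cdot> h) a (transpose_post f h a \<delta>)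
    = ((pn2 (eval V a) g \<lhd> (pf1 (ihom V a) f \<rtimes> a)) \<bullet> (g \<rhd> pn2 (eval V a) f)) \<lhd> (h \<rtimes> a)
      \<bullet> ((g \<cdot> f) \<rhd> \<delta>)"
  using assms cod_transposed[OF assms(2,3)] by (simp add: transpose_post_def)

text \<open>Two successive transpositions paste the two cells of \<epsilon> that occur in
  \<open>eval2_square\<close>; after that equation \<open>\<theta>\<close> only has to be exchanged
  with \<open>\<delta>\<close>.\<close>

lemma is_mate_square:
  assumes [simp]: "cod1 V f = dom1 V g" "cod1 V l = dom1 V k"
      "dom2 V \<theta> = g \<cdot> f" "cod2 V \<theta> = k \<cdot> l"
    and [simp]: "cod2 V \<delta> = ev V a (dom1 V f) \<cdot> (h \<rtimes> a)" "cod1 V h = hm V a (dom1 V f)"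
    and [simp]: "dom2 V \<delta> = j"
  shows "is_mate a (cod1 V g) (pf_square V (ihom V a) g f \<theta> k l \<lhd> h)
    (transpose_post g (pf1 (ihom V a) f \<cdot> h) a (transpose_post f h a \<delta>))
    (transpose_post k (pf1 (ihom V a) l \<cdot> h) a (transpose_post l h a \<delta>)) (\<theta> \<lhd> j)"
proof -
  have [simp]: "cod1 V k = cod1 V g" "dom1 V l = dom1 V f"
    using dom1_cod2[of \<theta>] cod1_cod2[of \<theta>] by simp_all
  note [simp] = cod_transposed[OF assms(5,6), simplified]
  let ?G = "ihom V a"
  let ?sq = "pf_square V ?G g f \<theta> k l"
  let ?E = "\<lambda>\<theta>. ev V a (cod1 V k) \<rhd> (\<theta> \<rtimes>\<^sub>2 a)"
  have "?E (?sq \<lhd> h) \<bullet> transpose_post g (pf1 (ihom V a) f \<cdot> h) a (transpose_post f h a \<delta>)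
    = (?E ?sq \<bullet> (pn2 (eval V a) g \<lhd> (pf1 ?G f \<rtimes> a)) \<bullet> (g \<rhd> pn2 (eval V a) f)) \<lhd> (h \<rtimes> a)
      \<bullet> ((g \<cdot> f) \<rhd> \<delta>)"
    unfolding transpose_post_twice[OF assms(1,5,6)] by simp
  also have "\<dots> = ((pn2 (eval V a) k \<lhd> (pf1 ?G l \<rtimes> a)) \<bullet> (k \<rhd> pn2 (eval V a) l)
      \<bullet> (\<theta> \<lhd> ev V a (dom1 V f))) \<lhd> (h \<rtimes> a) \<bullet> ((g \<cdot> f) \<rhd> \<delta>)"
    unfolding eval2_square[OF assms(1-4)] ..
  also have "\<dots> = ((pn2 (eval V a) k \<lhd> (pf1 ?G l \<rtimes> a)) \<bullet> (k \<rhd> pn2 (eval V a) l)) \<lhd> (h \<rtimes> a)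
      \<bullet> (\<theta> \<lhd> (ev V a (dom1 V f) \<cdot> (h \<rtimes> a))) \<bullet> ((g \<cdot> f) \<rhd> \<delta>)"
    by simp
  also have "(\<theta> \<lhd> (ev V a (dom1 V f) \<cdot> (h \<rtimes> a))) \<bullet> ((g \<cdot> f) \<rhd> \<delta>) = ((k \<cdot> l) \<rhd> \<delta>) \<bullet> (\<theta> \<lhd> j)"
    by (rule whisker_exchange) simp_all
  also have "((pn2 (eval V a) k \<lhd> (pf1 ?G l \<rtimes> a)) \<bullet> (k \<rhd> pn2 (eval V a) l)) \<lhd> (h \<rtimes> a)
      \<bullet> ((k \<cdot> l) \<rhd> \<delta>) \<bullet> (\<theta> \<lhd> j)
    = transpose_post k (pf1 (ihom V a) l \<cdot> h) a (transpose_post l h a \<delta>) \<bullet> (\<theta> \<lhd> j)"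
    by (subst transpose_post_twice) simp_all
  finally show ?thesis
    by (simp add: is_mate_def)
qed

lemma is_mate_triangle:
  assumes [simp]: "cod1 V f = dom1 V g" "dom2 V \<theta> = g \<cdot> f" "cod2 V \<theta> = \<one> B"
    and [simp]: "cod2 V \<delta> = ev V a B \<cdot> (h \<rtimes> a)" "cod1 V h = hm V a B" "dom2 V \<delta> = j"
  shows "is_mate a B (pf_triangle V (ihom V a) g f \<theta> B \<lhd> h)
    (transpose_post g (pf1 (ihom V a) f \<cdot> h) a (transpose_post f h a \<delta>)) \<delta> (\<theta> \<lhd> j)"
proof -
  have [simp]: "cod1 V g = B" "dom1 V f = B"
    using dom1_cod2[of \<theta>] cod1_cod2[of \<theta>] by simp_all
  note [simp] = cod_transposed[OF assms(4,5), simplified]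
  let ?G = "ihom V a"
  let ?tr = "pf_triangle V ?G g f \<theta> B"
  let ?E = "\<lambda>\<theta>. ev V a B \<rhd> (\<theta> \<rtimes>\<^sub>2 a)"
  have "?E (?tr \<lhd> h) \<bullet> transpose_post g (pf1 (ihom V a) f \<cdot> h) a (transpose_post f h a \<delta>)
    = (?E ?tr \<bullet> (pn2 (eval V a) g \<lhd> (pf1 ?G f \<rtimes> a)) \<bullet> (g \<rhd> pn2 (eval V a) f)) \<lhd> (h \<rtimes> a)
      \<bullet> ((g \<cdot> f) \<rhd> \<delta>)"
    by (subst transpose_post_twice) simp_all
  also have "\<dots> = (\<theta> \<lhd> ev V a B) \<lhd> (h \<rtimes> a) \<bullet> ((g \<cdot> f) \<rhd> \<delta>)"
    unfolding eval2_triangle[OF assms(1-3)] ..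
  also have "\<dots> = \<delta> \<bullet> (\<theta> \<lhd> j)"
    using whisker_exchange[of \<delta> \<theta>] by simp
  finally show ?thesis
    by (simp add: is_mate_def)
qed

text \<open>A rereading of \<open>tri_s_natural\<close>: under transposition the pseudonaturality
  cells of \<eta> are invisible.\<close>

lemma is_mate_coev:
  "is_mate a (cod1 V x \<otimes> a) (pn2 (coev V a) x)
    (transpose_post (x \<rtimes> a) (pn1 (coev V a) (dom1 V x)) a (tri_s V a (dom1 V x)))
    (tri_s V a (cod1 V x) \<lhd> (x \<rtimes> a)) (\<i> (x \<rtimes> a))"
  by (simp add: is_mate_def tri_s_natural) (simp add: transpose_post_def)

lemma is_mate_tri_t:
  "is_mate a B (tri_t V a B)
    (transpose_post (ev V a B) (pn1 (coev V a) (hm V a B)) a (tri_s V a (hm V a B)))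
    (\<i> (ev V a B)) (\<i> (ev V a B))"
  using tri_t_swallowtail[of a B] by (simp add: is_mate_def) (simp add: transpose_post_def)

lemma is_mate_post_square:
  assumes [simp]: "cod1 V f = dom1 V g" "cod1 V l = dom1 V k"
      "dom2 V \<theta> = g \<cdot> f" "cod2 V \<theta> = k \<cdot> l"
    and [simp]: "cod2 V \<delta> = ev V a (dom1 V f) \<cdot> (h \<rtimes> a)" "cod1 V h = hm V a (dom1 V f)"
    and [simp]: "dom2 V \<delta> = j" "cod1 V g = dom1 V r"
  shows "is_mate a (cod1 V r) (pf1 (ihom V a) r \<rhd> pf_square V (ihom V a) g f \<theta> k l \<lhd> h)
    (transpose_post r (pf1 (ihom V a) g \<cdot> pf1 (ihom V a) f \<cdot> h) a
      (transpose_post g (pf1 (ihom V a) f \<cdot> h) a (transpose_post f h a \<delta>)))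
    (transpose_post r (pf1 (ihom V a) k \<cdot> pf1 (ihom V a) l \<cdot> h) a
      (transpose_post k (pf1 (ihom V a) l \<cdot> h) a (transpose_post l h a \<delta>)))
    (r \<rhd> \<theta> \<lhd> j)"
proof -
  have [simp]: "cod1 V k = dom1 V r" "dom1 V l = dom1 V f"
    using dom1_cod2[of \<theta>] cod1_cod2[of \<theta>] by simp_all
  have "is_mate a (dom1 V r) (pf_square V (ihom V a) g f \<theta> k l \<lhd> h)
    (transpose_post g (pf1 (ihom V a) f \<cdot> h) a (transpose_post f h a \<delta>))
    (transpose_post k (pf1 (ihom V a) l \<cdot> h) a (transpose_post l h a \<delta>)) (\<theta> \<lhd> j)"
    using is_mate_square[OF assms(1-7)] by simp
  from is_mate_post[OF this] show ?thesis
    by simp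
qed

lemma is_mate_post_coev:
  assumes [simp]: "cod1 V f = dom1 V g" "dom1 V f = cod1 V x \<otimes> a"
  shows "is_mate a (cod1 V g) ((pf1 (ihom V a) g \<cdot> pf1 (ihom V a) f) \<rhd> pn2 (coev V a) x)
    (transpose_post g (pf1 (ihom V a) f \<cdot> pf1 (ihom V a) (x \<rtimes> a) \<cdot> pn1 (coev V a) (dom1 V x)) a
      (transpose_post f (pf1 (ihom V a) (x \<rtimes> a) \<cdot> pn1 (coev V a) (dom1 V x)) a
        (transpose_post (x \<rtimes> a) (pn1 (coev V a) (dom1 V x)) a (tri_s V a (dom1 V x)))))
    (transpose_post g (pf1 (ihom V a) f \<cdot> pn1 (coev V a) (cod1 V x)) a
      (transpose_post f (pn1 (coev V a) (cod1 V x)) a (tri_s V a (cod1 V x))) \<lhd> (x \<rtimes> a))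
    (\<i> (g \<cdot> f \<cdot> (x \<rtimes> a)))"
proof -
  have "is_mate a (dom1 V f) (pn2 (coev V a) x)
    (transpose_post (x \<rtimes> a) (pn1 (coev V a) (dom1 V x)) a (tri_s V a (dom1 V x)))
    (tri_s V a (cod1 V x) \<lhd> (x \<rtimes> a)) (\<i> (x \<rtimes> a))"
    using is_mate_coev[of a x] by simp
  from is_mate_post[OF this dom2_coev2 cod2_coev2]
  have "is_mate a (dom1 V g) (pf1 (ihom V a) f \<rhd> pn2 (coev V a) x)
    (transpose_post f (pf1 (ihom V a) (x \<rtimes> a) \<cdot> pn1 (coev V a) (dom1 V x)) a
      (transpose_post (x \<rtimes> a) (pn1 (coev V a) (dom1 V x)) a (tri_s V a (dom1 V x))))
    (transpose_post f (pn1 (coev V a) (cod1 V x)) a (tri_s V a (cod1 V x)) \<lhd> (x \<rtimes> a))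
    (\<i> (f \<cdot> (x \<rtimes> a)))"
    by (simp add: transpose_post_whisker_right)
  from is_mate_post[OF this refl refl] show ?thesis
    by (simp add: transpose_post_whisker_right)
qed


section \<open>The structural 2-cells of the self-enrichment\<close>

lemma dom1_self_mult [simp]: "dom1 V (self_mult V a b c) = hm V b c \<otimes> hm V a b"
  and cod1_self_mult [simp]: "cod1 V (self_mult V a b c) = hm V a c"
  by (simp_all add: self_mult_def)

lemma dom1_self_unit [simp]: "dom1 V (self_unit V a) = \<one>\<^sub>\<otimes>"
  and cod1_self_unit [simp]: "cod1 V (self_unit V a) = hm V a a"
  by (simp_all add: self_unit_def)

text \<open>The cell \<open>e\<^sup>-\<^sup>1\<close>, in which the structural cells are described without inverses.\<close>

definition ev_mult :: "'o \<Rightarrow> 'o \<Rightarrow> 'o \<Rightarrow> 't" where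
  "ev_mult a b c =
    (let k = hm V b c \<ltimes> ev V a b; \<eta> = pn1 (coev V a) (hm V b c \<otimes> hm V a b) in
      transpose_post (ev V b c) (pf1 (ihom V a) k \<cdot> \<eta>) a
        (transpose_post k \<eta> a (tri_s V a (hm V b c \<otimes> hm V a b))))"

lemma dom2_ev_mult [simp]: "dom2 V (ev_mult a b c) = ev V b c \<cdot> (hm V b c \<ltimes> ev V a b)"
  and cod2_ev_mult [simp]: "cod2 V (ev_mult a b c) = ev V a c \<cdot> (self_mult V a b c \<rtimes> a)"
  and invertible2_ev_mult [simp]: "invertible2 V (ev_mult a b c)"
  by (simp_all add: ev_mult_def self_mult_def Let_def)

text \<open>Both pastings consist of the same cells, one triangulator and two cells of \<epsilon>,
  inverted and in opposite order.\<close>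

lemma self_e_eq: "self_e V a b c = inv2 V (ev_mult a b c)"
  by (simp add: self_e_def ev_mult_def transpose_post_def Let_def inv2_vcomp inv2_whisker_left
      inv2_whisker_right)

text \<open>\<alpha> is a composite of five cells, each with a known mate: the two cells of \<eta>
  give identities, the three squares give an inverse interchanger, \<open>e\<close> and
  \<open>d\<close>. The first and last transposes are whiskered cells \<open>ev_mult\<close>. Moving
  the inverse mates to the other side leaves an equation without inverses.\<close>

lemma ev_self_assoc:
  "(ev V a d \<rhd> (self_assoc V a b c d \<rtimes>\<^sub>2 a))
      \<bullet> (ev_mult a b d \<lhd> (self_mult V b c d \<rtimes> (hm V a b \<otimes> a)))
      \<bullet> (ev V b d \<rhd> \<Sigma> (self_mult V b c d) (ev V a b))
      \<bullet> (ev_mult b c d \<lhd> ((hm V c d \<otimes> hm V b c) \<ltimes> ev V a b))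
    = (ev_mult a c d \<lhd> (hm V c d \<ltimes> (self_mult V a b c \<rtimes> a)))
      \<bullet> (ev V c d \<rhd> (hm V c d \<ltimes>\<^sub>2 ev_mult a b c))"
  and dom2_self_assoc: "dom2 V (self_assoc V a b c d)
    = self_mult V a b d \<cdot> (self_mult V b c d \<rtimes> hm V a b)"
  and cod2_self_assoc: "cod2 V (self_assoc V a b c d)
    = self_mult V a c d \<cdot> (hm V c d \<ltimes> self_mult V a b c)"
  and invertible2_self_assoc: "invertible2 V (self_assoc V a b c d)"
proof -
  let ?G = "pf1 (ihom V a)" and ?tp = "\<lambda>g h \<delta>. transpose_post g h a \<delta>"
  let ?sq = "pf_square V (ihom V a)"
  let ?H = "hm V c d \<otimes> hm V b c"
  let ?\<eta> = "pn1 (coev V a) (?H \<otimes> hm V a b)" and ?s = "tri_s V a (?H \<otimes> hm V a b)"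
  let ?m = "self_mult V b c d" and ?n = "self_mult V a b c"
  let ?mS = "?m \<rtimes> (hm V a b \<otimes> a)" and ?Pn = "hm V c d \<ltimes> (?n \<rtimes> a)"
  let ?\<epsilon>ab = "hm V b d \<ltimes> ev V a b" and ?\<epsilon>ab' = "?H \<ltimes> ev V a b"
  let ?\<epsilon>bc = "hm V c d \<ltimes> ev V b c" and ?\<epsilon>ac = "hm V c d \<ltimes> ev V a c"
  let ?\<theta>1 = "(?G (ev V b d) \<cdot> ?G ?\<epsilon>ab) \<rhd> inv2 V (pn2 (coev V a) (?m \<rtimes> hm V a b))"
  let ?\<theta>2 = "?G (ev V b d) \<rhd> ?sq ?\<epsilon>ab ?mS (inv2 V (\<Sigma> ?m (ev V a b))) (?m \<rtimes> b) ?\<epsilon>ab' \<lhd> ?\<eta>"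
  let ?\<theta>3 = "?sq (ev V b d) (?m \<rtimes> b) (self_e V b c d) (ev V c d) ?\<epsilon>bc \<lhd> (?G ?\<epsilon>ab' \<cdot> ?\<eta>)"
  let ?\<theta>4 = "?G (ev V c d)
    \<rhd> ?sq ?\<epsilon>bc ?\<epsilon>ab' (hm V c d \<ltimes>\<^sub>2 inv2 V (self_e V a b c)) ?\<epsilon>ac ?Pn \<lhd> ?\<eta>"
  let ?\<theta>5 = "(?G (ev V c d) \<cdot> ?G ?\<epsilon>ac) \<rhd> pn2 (coev V a) (hm V c d \<ltimes> ?n)"
  let ?\<delta>0 = "ev_mult a b d \<lhd> ?mS" and ?\<delta>5 = "ev_mult a c d \<lhd> ?Pn"
  let ?\<delta>1 = "?tp (ev V b d) (?G ?\<epsilon>ab \<cdot> ?G ?mS \<cdot> ?\<eta>) (?tp ?\<epsilon>ab (?G ?mS \<cdot> ?\<eta>) (?tp ?mS ?\<eta> ?s))"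
  let ?\<delta>2 = "?tp (ev V b d) (?G (?m \<rtimes> b) \<cdot> ?G ?\<epsilon>ab' \<cdot> ?\<eta>)
    (?tp (?m \<rtimes> b) (?G ?\<epsilon>ab' \<cdot> ?\<eta>) (?tp ?\<epsilon>ab' ?\<eta> ?s))"
  let ?\<delta>3 = "?tp (ev V c d) (?G ?\<epsilon>bc \<cdot> ?G ?\<epsilon>ab' \<cdot> ?\<eta>)
    (?tp ?\<epsilon>bc (?G ?\<epsilon>ab' \<cdot> ?\<eta>) (?tp ?\<epsilon>ab' ?\<eta> ?s))"
  let ?\<delta>4 = "?tp (ev V c d) (?G ?\<epsilon>ac \<cdot> ?G ?Pn \<cdot> ?\<eta>) (?tp ?\<epsilon>ac (?G ?Pn \<cdot> ?\<eta>) (?tp ?Pn ?\<eta> ?s))"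
  let ?\<omega>1 = "\<i> (ev V b d \<cdot> ?\<epsilon>ab \<cdot> ?mS)" and ?\<omega>2 = "ev V b d \<rhd> inv2 V (\<Sigma> ?m (ev V a b))"
  let ?\<omega>3 = "inv2 V (ev_mult b c d) \<lhd> ?\<epsilon>ab'"
  let ?\<omega>4 = "ev V c d \<rhd> (hm V c d \<ltimes>\<^sub>2 ev_mult a b c)" and ?\<omega>5 = "\<i> (ev V c d \<cdot> ?\<epsilon>ac \<cdot> ?Pn)"
  have 1: "is_mate a d ?\<theta>1 ?\<delta>0 ?\<delta>1 ?\<omega>1"
    using is_mate_inv2[OF is_mate_post_coev[of ?\<epsilon>ab "ev V b d" "?m \<rtimes> hm V a b" a]]
    by (simp add: ev_mult_def Let_def inv2_whisker_left)
  have 2: "is_mate a d ?\<theta>2 ?\<delta>1 ?\<delta>2 ?\<omega>2"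
    using is_mate_post_square[of ?mS ?\<epsilon>ab ?\<epsilon>ab' "?m \<rtimes> b" "inv2 V (\<Sigma> ?m (ev V a b))"
          ?s a ?\<eta> _ "ev V b d"] by simp
  have 3: "is_mate a d ?\<theta>3 ?\<delta>2 ?\<delta>3 ?\<omega>3"
    using is_mate_square[of "?m \<rtimes> b" "ev V b d" ?\<epsilon>bc "ev V c d" "self_e V b c d"
          "?tp ?\<epsilon>ab' ?\<eta> ?s" a "?G ?\<epsilon>ab' \<cdot> ?\<eta>"] by (simp add: self_e_eq)
  have 4: "is_mate a d ?\<theta>4 ?\<delta>3 ?\<delta>4 ?\<omega>4"
    using is_mate_post_square[of ?\<epsilon>ab' ?\<epsilon>bc ?Pn ?\<epsilon>ac
          "hm V c d \<ltimes>\<^sub>2 inv2 V (self_e V a b c)" ?s a ?\<eta> _ "ev V c d"]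
    by (simp add: self_e_eq)
  have 5: "is_mate a d ?\<theta>5 ?\<delta>4 ?\<delta>5 ?\<omega>5"
    using is_mate_post_coev[of ?\<epsilon>ac "ev V c d" "hm V c d \<ltimes> ?n" a]
    by (simp add: ev_mult_def Let_def)
  have assoc: "self_assoc V a b c d = ?\<theta>5 \<bullet> (?\<theta>4 \<bullet> (?\<theta>3 \<bullet> (?\<theta>2 \<bullet> ?\<theta>1)))"
    by (simp add: self_assoc_def Let_def)
  show typing: "dom2 V (self_assoc V a b c d) = self_mult V a b d \<cdot> (?m \<rtimes> hm V a b)"
    "cod2 V (self_assoc V a b c d) = self_mult V a c d \<cdot> (hm V c d \<ltimes> ?n)"
    "invertible2 V (self_assoc V a b c d)"
    unfolding assoc by (simp_all add: self_mult_def[of V a b d] self_mult_def[of V a c d] self_e_eq)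
  have "is_mate a d (self_assoc V a b c d) ?\<delta>0 ?\<delta>5
      (?\<omega>5 \<bullet> ?\<omega>4 \<bullet> ?\<omega>3 \<bullet> ?\<omega>2 \<bullet> ?\<omega>1)"
    unfolding assoc
    by (intro is_mate_vcomp[OF is_mate_vcomp[OF is_mate_vcomp[OF is_mate_vcomp[OF 1 2] 3] 4] 5])
      (simp_all add: self_e_eq)
  then have mate: "(ev V a d \<rhd> (self_assoc V a b c d \<rtimes>\<^sub>2 a)) \<bullet> ?\<delta>0 = ?\<delta>5 \<bullet> ?\<omega>4 \<bullet> ?\<omega>3 \<bullet> ?\<omega>2"
    by (simp add: is_mate_def)
  show "(ev V a d \<rhd> (self_assoc V a b c d \<rtimes>\<^sub>2 a)) \<bullet> ?\<delta>0
      \<bullet> (ev V b d \<rhd> \<Sigma> ?m (ev V a b)) \<bullet> (ev_mult b c d \<lhd> ?\<epsilon>ab') = ?\<delta>5 \<bullet> ?\<omega>4"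
    \<comment> \<open>The appended composite is inverse to
      \<open>?\<omega>3 \<bullet> ?\<omega>2\<close>, so these two mates cancel on the
      right.\<close>
    using vcomp_left_cong[OF mate, of "(ev V b d \<rhd> \<Sigma> ?m (ev V a b)) \<bullet> (ev_mult b c d \<lhd> ?\<epsilon>ab')"]
    by (simp add: typing inv2_whisker_left[symmetric] inv2_whisker_right[symmetric])
qed

text \<open>As for \<alpha>, with a triangle in place of the squares for \<open>e\<close> and
  \<open>d\<close>, and with the final cell \<open>t\<close>, whose mate is an identity by the
  swallowtail equation; hence the right-hand side is an identity.\<close>

lemma ev_self_lunit:
  "(ev V a b \<rhd> (self_lunit V a b \<rtimes>\<^sub>2 a))
      \<bullet> (ev_mult a b b \<lhd> (self_unit V b \<rtimes> (hm V a b \<otimes> a)))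
      \<bullet> (ev V b b \<rhd> \<Sigma> (self_unit V b) (ev V a b))
      \<bullet> (tri_s V b \<one>\<^sub>\<otimes> \<lhd> ev V a b) = \<i> (ev V a b)"
  and dom2_self_lunit: "dom2 V (self_lunit V a b)
    = self_mult V a b b \<cdot> (self_unit V b \<rtimes> hm V a b)"
  and cod2_self_lunit: "cod2 V (self_lunit V a b) = \<one> (hm V a b)"
  and invertible2_self_lunit: "invertible2 V (self_lunit V a b)"
proof -
  let ?G = "pf1 (ihom V a)" and ?tp = "\<lambda>g h \<delta>. transpose_post g h a \<delta>"
  let ?\<eta> = "pn1 (coev V a) (hm V a b)" and ?s = "tri_s V a (hm V a b)"
  let ?u = "self_unit V b"
  let ?uH = "?u \<rtimes> (hm V a b \<otimes> a)" and ?\<epsilon>' = "hm V b b \<ltimes> ev V a b"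
  let ?\<theta>1 = "(?G (ev V b b) \<cdot> ?G ?\<epsilon>') \<rhd> inv2 V (pn2 (coev V a) (?u \<rtimes> hm V a b))"
  let ?\<theta>2 = "?G (ev V b b) \<rhd> pf_square V (ihom V a) ?\<epsilon>' ?uH (inv2 V (\<Sigma> ?u (ev V a b)))
    (?u \<rtimes> b) (ev V a b) \<lhd> ?\<eta>"
  let ?\<theta>3 = "pf_triangle V (ihom V a) (ev V b b) (?u \<rtimes> b) (inv2 V (tri_s V b \<one>\<^sub>\<otimes>)) b
    \<lhd> (?G (ev V a b) \<cdot> ?\<eta>)"
  let ?\<delta>0 = "ev_mult a b b \<lhd> ?uH" and ?\<delta>3 = "?tp (ev V a b) ?\<eta> ?s"
  let ?\<delta>1 = "?tp (ev V b b) (?G ?\<epsilon>' \<cdot> ?G ?uH \<cdot> ?\<eta>) (?tp ?\<epsilon>' (?G ?uH \<cdot> ?\<eta>) (?tp ?uH ?\<eta> ?s))"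
  let ?\<delta>2 = "?tp (ev V b b) (?G (?u \<rtimes> b) \<cdot> ?G (ev V a b) \<cdot> ?\<eta>)
    (?tp (?u \<rtimes> b) (?G (ev V a b) \<cdot> ?\<eta>) ?\<delta>3)"
  let ?\<omega>1 = "\<i> (ev V b b \<cdot> ?\<epsilon>' \<cdot> ?uH)" and ?\<omega>2 = "ev V b b \<rhd> inv2 V (\<Sigma> ?u (ev V a b))"
  let ?\<omega>3 = "inv2 V (tri_s V b \<one>\<^sub>\<otimes>) \<lhd> ev V a b"
  \<comment> \<open>Folding the unit makes the target of
    \<open>tri_s V b \<one>\<^sub>\<otimes>\<close> read
    \<open>ev V b b \<cdot> (u \<rtimes> b)\<close>, the form in which the triangle is
    built.\<close>
  note [simp] = self_unit_def[symmetric]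
  have 1: "is_mate a b ?\<theta>1 ?\<delta>0 ?\<delta>1 ?\<omega>1"
    using is_mate_inv2[OF is_mate_post_coev[of ?\<epsilon>' "ev V b b" "?u \<rtimes> hm V a b" a]]
    by (simp add: ev_mult_def Let_def inv2_whisker_left)
  have 2: "is_mate a b ?\<theta>2 ?\<delta>1 ?\<delta>2 ?\<omega>2"
    using is_mate_post_square[of ?uH ?\<epsilon>' "ev V a b" "?u \<rtimes> b" "inv2 V (\<Sigma> ?u (ev V a b))"
        ?s a ?\<eta> _ "ev V b b"] by simp
  have 3: "is_mate a b ?\<theta>3 ?\<delta>2 ?\<delta>3 ?\<omega>3"
    using is_mate_triangle[of "?u \<rtimes> b" "ev V b b" "inv2 V (tri_s V b \<one>\<^sub>\<otimes>)" b ?\<delta>3 a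
        "?G (ev V a b) \<cdot> ?\<eta>"] by simp
  have lunit: "self_lunit V a b = tri_t V a b \<bullet> (?\<theta>3 \<bullet> (?\<theta>2 \<bullet> ?\<theta>1))"
    by (simp add: self_lunit_def Let_def)
  show typing: "dom2 V (self_lunit V a b) = self_mult V a b b \<cdot> (?u \<rtimes> hm V a b)"
    "cod2 V (self_lunit V a b) = \<one> (hm V a b)" "invertible2 V (self_lunit V a b)"
    unfolding lunit by (simp_all add: self_mult_def)
  have "is_mate a b (self_lunit V a b) ?\<delta>0 (\<i> (ev V a b)) (\<i> (ev V a b) \<bullet> (?\<omega>3 \<bullet> (?\<omega>2 \<bullet> ?\<omega>1)))"
    unfolding lunit
    by (intro is_mate_vcomp[OF is_mate_vcomp[OF is_mate_vcomp[OF 1 2] 3] is_mate_tri_t]) simp_all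
  then have mate: "(ev V a b \<rhd> (self_lunit V a b \<rtimes>\<^sub>2 a)) \<bullet> ?\<delta>0 = ?\<omega>3 \<bullet> ?\<omega>2"
    by (simp add: is_mate_def)
  show "(ev V a b \<rhd> (self_lunit V a b \<rtimes>\<^sub>2 a)) \<bullet> ?\<delta>0
      \<bullet> (ev V b b \<rhd> \<Sigma> ?u (ev V a b)) \<bullet> (tri_s V b \<one>\<^sub>\<otimes> \<lhd> ev V a b) = \<i> (ev V a b)"
    using vcomp_left_cong[OF mate, of "(ev V b b \<rhd> \<Sigma> ?u (ev V a b)) \<bullet> (tri_s V b \<one>\<^sub>\<otimes> \<lhd> ev V a b)"]
    by (simp add: typing inv2_whisker_left[symmetric] inv2_whisker_right[symmetric])
qed

text \<open>No interchanger occurs: the unit and the evaluation that consumes it both act to the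
  right of \<open>hm V a b\<close>, so they form a triangle at once.\<close>

lemma ev_self_runit:
  "(ev V a b \<rhd> (self_runit V a b \<rtimes>\<^sub>2 a))
      \<bullet> (ev_mult a a b \<lhd> (hm V a b \<ltimes> (self_unit V a \<rtimes> a)))
      \<bullet> (ev V a b \<rhd> (hm V a b \<ltimes>\<^sub>2 tri_s V a \<one>\<^sub>\<otimes>)) = \<i> (ev V a b)"
  and dom2_self_runit: "dom2 V (self_runit V a b)
    = self_mult V a a b \<cdot> (hm V a b \<ltimes> self_unit V a)"
  and cod2_self_runit: "cod2 V (self_runit V a b) = \<one> (hm V a b)"
  and invertible2_self_runit: "invertible2 V (self_runit V a b)"
proof -
  let ?G = "pf1 (ihom V a)" and ?tp = "\<lambda>g h \<delta>. transpose_post g h a \<delta>"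
  let ?\<eta> = "pn1 (coev V a) (hm V a b)" and ?s = "tri_s V a (hm V a b)"
  let ?u = "self_unit V a"
  let ?Hu = "hm V a b \<ltimes> (?u \<rtimes> a)" and ?\<epsilon>' = "hm V a b \<ltimes> ev V a a"
  let ?\<theta>1 = "(?G (ev V a b) \<cdot> ?G ?\<epsilon>') \<rhd> inv2 V (pn2 (coev V a) (hm V a b \<ltimes> ?u))"
  let ?\<theta>2 = "?G (ev V a b) \<rhd> pf_triangle V (ihom V a) ?\<epsilon>' ?Hu
    (hm V a b \<ltimes>\<^sub>2 inv2 V (tri_s V a \<one>\<^sub>\<otimes>)) (hm V a b \<otimes> a) \<lhd> ?\<eta>"
  let ?\<delta>0 = "ev_mult a a b \<lhd> ?Hu" and ?\<delta>2 = "?tp (ev V a b) ?\<eta> ?s"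
  let ?\<delta>1 = "?tp (ev V a b) (?G ?\<epsilon>' \<cdot> ?G ?Hu \<cdot> ?\<eta>) (?tp ?\<epsilon>' (?G ?Hu \<cdot> ?\<eta>) (?tp ?Hu ?\<eta> ?s))"
  let ?\<omega>1 = "\<i> (ev V a b \<cdot> ?\<epsilon>' \<cdot> ?Hu)"
  let ?\<omega>2 = "ev V a b \<rhd> (hm V a b \<ltimes>\<^sub>2 inv2 V (tri_s V a \<one>\<^sub>\<otimes>))"
  note [simp] = self_unit_def[symmetric]
  have 1: "is_mate a b ?\<theta>1 ?\<delta>0 ?\<delta>1 ?\<omega>1"
    using is_mate_inv2[OF is_mate_post_coev[of ?\<epsilon>' "ev V a b" "hm V a b \<ltimes> ?u" a]]
    by (simp add: ev_mult_def Let_def inv2_whisker_left)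
  have "is_mate a (dom1 V (ev V a b)) (pf_triangle V (ihom V a) ?\<epsilon>' ?Hu
      (hm V a b \<ltimes>\<^sub>2 inv2 V (tri_s V a \<one>\<^sub>\<otimes>)) (hm V a b \<otimes> a) \<lhd> ?\<eta>)
    (?tp ?\<epsilon>' (?G ?Hu \<cdot> ?\<eta>) (?tp ?Hu ?\<eta> ?s)) ?s (hm V a b \<ltimes>\<^sub>2 inv2 V (tri_s V a \<one>\<^sub>\<otimes>))"
    using is_mate_triangle[of ?Hu ?\<epsilon>' "hm V a b \<ltimes>\<^sub>2 inv2 V (tri_s V a \<one>\<^sub>\<otimes>)" "hm V a b \<otimes> a" ?s a ?\<eta>]
    by simp
  from is_mate_post[OF this refl refl] have 2: "is_mate a b ?\<theta>2 ?\<delta>1 ?\<delta>2 ?\<omega>2"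
    by simp
  have runit: "self_runit V a b = tri_t V a b \<bullet> (?\<theta>2 \<bullet> ?\<theta>1)"
    by (simp add: self_runit_def Let_def)
  show typing: "dom2 V (self_runit V a b) = self_mult V a a b \<cdot> (hm V a b \<ltimes> ?u)"
    "cod2 V (self_runit V a b) = \<one> (hm V a b)" "invertible2 V (self_runit V a b)"
    unfolding runit by (simp_all add: self_mult_def)
  have "is_mate a b (self_runit V a b) ?\<delta>0 (\<i> (ev V a b)) (\<i> (ev V a b) \<bullet> (?\<omega>2 \<bullet> ?\<omega>1))"
    unfolding runit by (intro is_mate_vcomp[OF is_mate_vcomp[OF 1 2] is_mate_tri_t]) simp_all
  then have mate: "(ev V a b \<rhd> (self_runit V a b \<rtimes>\<^sub>2 a)) \<bullet> ?\<delta>0 = ?\<omega>2"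
    by (simp add: is_mate_def)
  have "((ev V a b \<rhd> (self_runit V a b \<rtimes>\<^sub>2 a)) \<bullet> ?\<delta>0)
      \<bullet> (ev V a b \<rhd> (hm V a b \<ltimes>\<^sub>2 tri_s V a \<one>\<^sub>\<otimes>)) = \<i> (ev V a b)"
    unfolding mate by (simp add: inv2_ltensor2[symmetric] inv2_whisker_left[symmetric])
  then show "(ev V a b \<rhd> (self_runit V a b \<rtimes>\<^sub>2 a)) \<bullet> ?\<delta>0
      \<bullet> (ev V a b \<rhd> (hm V a b \<ltimes>\<^sub>2 tri_s V a \<one>\<^sub>\<otimes>)) = \<i> (ev V a b)"
    by (simp add: typing)
qed

declare dom2_self_assoc [simp] cod2_self_assoc [simp] invertible2_self_assoc [simp]
  dom2_self_lunit [simp] cod2_self_lunit [simp] invertible2_self_lunit [simp]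
  dom2_self_runit [simp] cod2_self_runit [simp] invertible2_self_runit [simp]


section \<open>The axioms\<close>

text \<open>By \<open>ev_faithful\<close> it suffices to compare transposes. After precomposition
  with \<open>?W\<close> both become \<open>ev_mult a b c\<close>: on the left the equation for
  \<alpha> and then the one for \<lambda> consume the rest of \<open>?W\<close>, on the right the
  equation for \<rho> does.\<close>

lemma self_enrichment_IC:
  "(self_mult V a b c \<rhd> (hm V b c \<ltimes>\<^sub>2 self_lunit V a b))
      \<bullet> (self_assoc V a b b c \<lhd> (hm V b c \<ltimes> (self_unit V b \<rtimes> hm V a b)))
    = self_mult V a b c \<rhd> (self_runit V b c \<rtimes>\<^sub>2 hm V a b)" (is "?lhs = ?rhs")
proof -
  let ?X = "hm V b c" and ?U = "hm V b b" and ?Y = "hm V a b" and ?u = "self_unit V b"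
  let ?m = "self_mult V b b c" and ?n = "self_mult V a b b" and ?\<mu> = "self_mult V a b c"
  let ?\<epsilon> = "ev V a b" and ?\<epsilon>' = "ev V b c" and ?s = "tri_s V b \<one>\<^sub>\<otimes>"
  let ?\<alpha> = "self_assoc V a b b c" and ?lu = "self_lunit V a b" and ?ru = "self_runit V b c"
  let ?d = "ev_mult a b c" and ?d1 = "ev_mult a b b" and ?d2 = "ev_mult b b c"
  let ?v = "?X \<ltimes> (?u \<rtimes> (?Y \<otimes> a))"
  let ?E = "\<lambda>\<theta>. ev V a c \<rhd> (\<theta> \<rtimes>\<^sub>2 a)"
  let ?A1 = "?d \<lhd> ((?m \<rtimes> (?Y \<otimes> a)) \<cdot> ?v)" and ?A2 = "?\<epsilon>' \<rhd> \<Sigma> ?m ?\<epsilon> \<lhd> ?v"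
  let ?A3 = "?d2 \<lhd> (((?X \<otimes> ?U) \<ltimes> ?\<epsilon>) \<cdot> ?v)"
  let ?A4 = "(?\<epsilon>' \<cdot> (?X \<ltimes> ev V b b)) \<rhd> (?X \<ltimes>\<^sub>2 \<Sigma> ?u ?\<epsilon>)"
  let ?A5 = "?\<epsilon>' \<rhd> (?X \<ltimes>\<^sub>2 ?s) \<lhd> (?X \<ltimes> ?\<epsilon>)"
  let ?El = "(ev V a c \<cdot> (?\<mu> \<rtimes> a)) \<rhd> (?X \<ltimes>\<^sub>2 (?lu \<rtimes>\<^sub>2 a))"
  let ?E\<alpha> = "?E ?\<alpha> \<lhd> ?v"
  let ?dn = "?d \<lhd> ((?X \<ltimes> (?n \<rtimes> a)) \<cdot> ?v)" and ?Xd = "?\<epsilon>' \<rhd> (?X \<ltimes>\<^sub>2 ?d1) \<lhd> ?v"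
  let ?l = "(?\<epsilon>' \<cdot> (?X \<ltimes> ?\<epsilon>)) \<rhd> (?X \<ltimes>\<^sub>2 (?lu \<rtimes>\<^sub>2 a))"
  let ?Er = "(ev V a c \<cdot> (?\<mu> \<rtimes> a)) \<rhd> (?ru \<rtimes>\<^sub>2 (?Y \<otimes> a))"
  let ?r = "(?\<epsilon>' \<cdot> (?X \<ltimes> ?\<epsilon>)) \<rhd> (?ru \<rtimes>\<^sub>2 (?Y \<otimes> a))"
  let ?r' = "?\<epsilon>' \<rhd> (?ru \<rtimes>\<^sub>2 b) \<lhd> (?X \<ltimes> ?\<epsilon>)"
  let ?B3 = "(?\<epsilon>' \<cdot> (?m \<rtimes> b)) \<rhd> (?X \<ltimes>\<^sub>2 \<Sigma> ?u ?\<epsilon>)"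
  let ?B4 = "?d2 \<lhd> ((?X \<ltimes> (?u \<rtimes> b)) \<cdot> (?X \<ltimes> ?\<epsilon>))"
  \<comment> \<open>\<open>?A1\<close>, \<open>?A2\<close>, \<open>?A3\<close> are the factors that
    the equation for \<alpha> consumes; \<open>?A4\<close> and \<open>?A5\<close> are those of the
    equation for \<lambda>, tensored with \<open>?X\<close> on the left.\<close>
  let ?W = "?A1 \<bullet> ?A2 \<bullet> ?A3 \<bullet> ?A4 \<bullet> ?A5"
  note [simp] = self_unit_def[symmetric]
  have L1: "?E\<alpha> \<bullet> ?A1 \<bullet> ?A2 \<bullet> ?A3 = ?dn \<bullet> ?Xd"
    using arg_cong[OF ev_self_assoc[of a c b b], of "\<lambda>\<theta>. \<theta> \<lhd> ?v"] by simp
  have L2: "?El \<bullet> ?dn = ?d \<bullet> ?l"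
    using whisker_exchange[OF _ refl refl refl refl, of "?X \<ltimes>\<^sub>2 (?lu \<rtimes>\<^sub>2 a)" ?d] by simp
  have L3: "?l \<bullet> ?Xd \<bullet> ?A4 \<bullet> ?A5 = \<i> (?\<epsilon>' \<cdot> (?X \<ltimes> ?\<epsilon>))"
    using arg_cong[OF ev_self_lunit[of a b], of "\<lambda>\<theta>. ?\<epsilon>' \<rhd> (?X \<ltimes>\<^sub>2 \<theta>)"] by simp
  have "?E ?lhs \<bullet> ?W = ?El \<bullet> (?E\<alpha> \<bullet> ?A1 \<bullet> ?A2 \<bullet> ?A3) \<bullet> ?A4 \<bullet> ?A5"
    by simp
  also note L1
  also have "?El \<bullet> (?dn \<bullet> ?Xd) \<bullet> ?A4 \<bullet> ?A5 = (?El \<bullet> ?dn) \<bullet> ?Xd \<bullet> ?A4 \<bullet> ?A5"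
    by simp
  also note L2
  also have "(?d \<bullet> ?l) \<bullet> ?Xd \<bullet> ?A4 \<bullet> ?A5 = ?d \<bullet> (?l \<bullet> ?Xd \<bullet> ?A4 \<bullet> ?A5)"
    by simp
  also note L3
  also have "?d \<bullet> \<i> (?\<epsilon>' \<cdot> (?X \<ltimes> ?\<epsilon>)) = ?d"
    by simp
  finally have lhs: "?E ?lhs \<bullet> ?W = ?d" .
  have R1: "?Er \<bullet> ?A1 = ?d \<bullet> ?r"
    using whisker_exchange[OF _ refl refl refl refl, of "?ru \<rtimes>\<^sub>2 (?Y \<otimes> a)" ?d] by simp
  have R2: "?A3 \<bullet> ?A4 = ?B3 \<bullet> ?B4"
    using whisker_exchange[OF _ refl refl refl refl, of "?X \<ltimes>\<^sub>2 \<Sigma> ?u ?\<epsilon>" ?d2] by simp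
  \<comment> \<open>\<open>?A2\<close> and \<open>?B3\<close> together form the interchanger of
    \<open>m(1u)\<close> with \<epsilon>. Naturality in \<rho> replaces it by the interchanger of an
    identity, which is trivial.\<close>
  have R3: "?r \<bullet> ?A2 \<bullet> ?B3 = ?r'"
    using arg_cong[OF interchanger_natural_left[of ?ru "?m \<cdot> (?X \<ltimes> ?u)" "\<one> ?X" ?\<epsilon>],
        of "\<lambda>\<theta>. ?\<epsilon>' \<rhd> \<theta>"]
    by (simp add: interchanger_comp1_left interchanger_tensor)
  have R4: "?r' \<bullet> ?B4 \<bullet> ?A5 = \<i> (?\<epsilon>' \<cdot> (?X \<ltimes> ?\<epsilon>))"
    using arg_cong[OF ev_self_runit[of b c], of "\<lambda>\<theta>. \<theta> \<lhd> (?X \<ltimes> ?\<epsilon>)"] by simp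
  have "?E ?rhs \<bullet> ?W = (?Er \<bullet> ?A1) \<bullet> ?A2 \<bullet> (?A3 \<bullet> ?A4) \<bullet> ?A5"
    by simp
  also note R1
  also note R2
  also have "(?d \<bullet> ?r) \<bullet> ?A2 \<bullet> (?B3 \<bullet> ?B4) \<bullet> ?A5 = ?d \<bullet> (?r \<bullet> ?A2 \<bullet> ?B3) \<bullet> ?B4 \<bullet> ?A5"
    by simp
  also note R3
  also note R4
  also have "?d \<bullet> \<i> (?\<epsilon>' \<cdot> (?X \<ltimes> ?\<epsilon>)) = ?d"
    by simp
  finally have rhs: "?E ?rhs \<bullet> ?W = ?d" .
  have "?E ?lhs = ?E ?rhs"
    by (rule vcomp_right_cancel[OF trans[OF lhs rhs[symmetric]]]) simp_all
  then show ?thesis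
    by (rule ev_faithful) simp_all
qed

text \<open>\<open>?W\<close> compares iterated evaluation with the multiplication bracketed to the
  left, \<open>?N1 \<bullet> ?N2 \<bullet> ?N3\<close> with the one bracketed to the right. The
  transpose of either side of the axiom carries the first comparison to the second, and
  \<open>?W\<close> can be cancelled.\<close>

lemma self_enrichment_AC:
  "(self_mult V a d e \<rhd> (hm V d e \<ltimes>\<^sub>2 self_assoc V a b c d))
      \<bullet> (self_assoc V a b d e \<lhd> (hm V d e \<ltimes> (self_mult V b c d \<rtimes> hm V a b)))
      \<bullet> (self_mult V a b e \<rhd> (self_assoc V b c d e \<rtimes>\<^sub>2 hm V a b))
    = (self_assoc V a c d e \<lhd> ((hm V d e \<otimes> hm V c d) \<ltimes> self_mult V a b c))
      \<bullet> (self_mult V a c e \<rhd> inv2 V (\<Sigma> (self_mult V c d e) (self_mult V a b c)))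
      \<bullet> (self_assoc V a b c e \<lhd> (self_mult V c d e \<rtimes> (hm V b c \<otimes> hm V a b)))"
  (is "?lhs = ?rhs")
proof -
  let ?P = "hm V d e" and ?Q = "hm V c d" and ?R = "hm V b c" and ?S = "hm V a b"
  let ?M = "self_mult V" and ?D = ev_mult and ?\<epsilon> = "ev V"
  let ?E = "\<lambda>\<theta>. ?\<epsilon> a e \<rhd> (\<theta> \<rtimes>\<^sub>2 a)"
  let ?\<epsilon>3 = "(?P \<otimes> ?Q \<otimes> ?R) \<ltimes> ?\<epsilon> a b" and ?\<epsilon>2 = "(?P \<otimes> ?Q) \<ltimes> ?\<epsilon> b c"
  let ?mRS = "?M c d e \<rtimes> (?R \<otimes> ?S \<otimes> a)" and ?PmS = "?P \<ltimes> (?M b c d \<rtimes> (?S \<otimes> a))"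
  let ?PQm = "(?P \<otimes> ?Q) \<ltimes> (?M a b c \<rtimes> a)"
  let ?W1 = "?D a b e \<lhd> ((?M b c e \<rtimes> (?S \<otimes> a)) \<cdot> ?mRS)"
  \<comment> \<open>The interchanger of the composite \<open>m(m1)\<close> is kept whole so that
    naturality in \<alpha> applies to it in \<open>S2\<close>; the other side splits it in
    \<open>T1\<close>.\<close>
  let ?W2 = "?\<epsilon> b e \<rhd> \<Sigma> (?M b c e \<cdot> (?M c d e \<rtimes> ?R)) (?\<epsilon> a b)"
  let ?W3 = "?D b c e \<lhd> ((?M c d e \<rtimes> (?R \<otimes> b)) \<cdot> ?\<epsilon>3)"
  let ?W4 = "?\<epsilon> c e \<rhd> \<Sigma> (?M c d e) (?\<epsilon> b c) \<lhd> ?\<epsilon>3"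
  let ?W5 = "?D c d e \<lhd> (?\<epsilon>2 \<cdot> ?\<epsilon>3)"
  let ?W = "?W1 \<bullet> ?W2 \<bullet> ?W3 \<bullet> ?W4 \<bullet> ?W5"
  let ?N1 = "?D a d e \<lhd> ((?P \<ltimes> (?M a c d \<rtimes> a)) \<cdot> ?PQm)"
  let ?N2 = "?\<epsilon> d e \<rhd> (?P \<ltimes>\<^sub>2 ?D a c d) \<lhd> ?PQm"
  let ?N3 = "(?\<epsilon> d e \<cdot> (?P \<ltimes> ?\<epsilon> c d)) \<rhd> ((?P \<otimes> ?Q) \<ltimes>\<^sub>2 ?D a b c)"

  let ?l1 = "(?\<epsilon> a e \<cdot> (?M a b e \<rtimes> a)) \<rhd> (self_assoc V b c d e \<rtimes>\<^sub>2 (?S \<otimes> a))"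
  let ?l2 = "?E (self_assoc V a b d e) \<lhd> ?PmS"
  let ?l3 = "(?\<epsilon> a e \<cdot> (?M a d e \<rtimes> a)) \<rhd> (?P \<ltimes>\<^sub>2 (self_assoc V a b c d \<rtimes>\<^sub>2 a))"
  let ?A1 = "?D a b e \<lhd> ((?M b d e \<rtimes> (?S \<otimes> a)) \<cdot> ?PmS)"
  let ?A2 = "(?\<epsilon> b e \<cdot> (hm V b e \<ltimes> ?\<epsilon> a b)) \<rhd> (self_assoc V b c d e \<rtimes>\<^sub>2 (?S \<otimes> a))"
  let ?A3 = "?\<epsilon> b e \<rhd> \<Sigma> (?M b d e \<cdot> (?P \<ltimes> ?M b c d)) (?\<epsilon> a b)"
  let ?A4 = "?\<epsilon> b e \<rhd> (self_assoc V b c d e \<rtimes>\<^sub>2 b) \<lhd> ?\<epsilon>3"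
  let ?A5 = "?D b d e \<lhd> ((?P \<ltimes> (?M b c d \<rtimes> b)) \<cdot> ?\<epsilon>3)"
  let ?A6 = "?\<epsilon> d e \<rhd> (?P \<ltimes>\<^sub>2 ?D b c d) \<lhd> ?\<epsilon>3"
  let ?A7 = "?\<epsilon> b e \<rhd> \<Sigma> (?M b d e) (?\<epsilon> a b) \<lhd> ?PmS"
  let ?A8 = "?D b d e \<lhd> (((?P \<otimes> hm V b d) \<ltimes> ?\<epsilon> a b) \<cdot> ?PmS)"
  let ?A9 = "(?\<epsilon> d e \<cdot> (?P \<ltimes> ?\<epsilon> b d)) \<rhd> (?P \<ltimes>\<^sub>2 \<Sigma> (?M b c d) (?\<epsilon> a b))"
  let ?A10 = "?D a d e \<lhd> ((?P \<ltimes> (?M a b d \<rtimes> a)) \<cdot> ?PmS)"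
  let ?A11 = "?\<epsilon> d e \<rhd> (?P \<ltimes>\<^sub>2 ?D a b d) \<lhd> ?PmS"
  let ?A12 = "(?\<epsilon> d e \<cdot> (?P \<ltimes> ?\<epsilon> a d)) \<rhd> (?P \<ltimes>\<^sub>2 (self_assoc V a b c d \<rtimes>\<^sub>2 a))"
  \<comment> \<open>\<open>S3\<close>, \<open>S5\<close> and \<open>S7\<close> use the equation for
    \<alpha> once for each of its three occurrences. In between, \<open>S2\<close> moves an
    interchanger past \<alpha>, \<open>S4\<close> splits the resulting interchanger of
    \<open>m(1m)\<close>, and \<open>S1\<close> and \<open>S6\<close> are exchanges.\<close>
  have S1: "?l1 \<bullet> ?W1 = ?A1 \<bullet> ?A2"
    using whisker_exchange[OF _ refl refl refl refl,
        of "self_assoc V b c d e \<rtimes>\<^sub>2 (?S \<otimes> a)" "?D a b e"] by simp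
  have S2: "?A2 \<bullet> ?W2 = ?A3 \<bullet> ?A4"
    using arg_cong[OF interchanger_natural_left[OF refl refl, of "self_assoc V b c d e" "?\<epsilon> a b"],
        of "\<lambda>\<theta>. ?\<epsilon> b e \<rhd> \<theta>"] by simp
  have S3: "?A4 \<bullet> ?W3 \<bullet> ?W4 \<bullet> ?W5 = ?A5 \<bullet> ?A6"
    using arg_cong[OF ev_self_assoc[of b e c d], of "\<lambda>\<theta>. \<theta> \<lhd> ?\<epsilon>3"] by simp
  have S4: "?A3 \<bullet> ?A5 = ?A7 \<bullet> ?A8 \<bullet> ?A9"
    using whisker_exchange[OF _ refl refl refl refl,
        of "?P \<ltimes>\<^sub>2 \<Sigma> (?M b c d) (?\<epsilon> a b)" "?D b d e"]
    by (simp add: interchanger_comp1_left interchanger_tensor)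
  have S5: "?l2 \<bullet> ?A1 \<bullet> ?A7 \<bullet> ?A8 = ?A10 \<bullet> ?A11"
    using arg_cong[OF ev_self_assoc[of a e b d], of "\<lambda>\<theta>. \<theta> \<lhd> ?PmS"] by simp
  have S6: "?l3 \<bullet> ?A10 = ?N1 \<bullet> ?A12"
    using whisker_exchange[OF _ refl refl refl refl,
        of "?P \<ltimes>\<^sub>2 (self_assoc V a b c d \<rtimes>\<^sub>2 a)" "?D a d e"] by simp
  have S7: "?A12 \<bullet> ?A11 \<bullet> ?A9 \<bullet> ?A6 = ?N2 \<bullet> ?N3"
    using arg_cong[OF ev_self_assoc[of a d b c], of "\<lambda>\<theta>. ?\<epsilon> d e \<rhd> (?P \<ltimes>\<^sub>2 \<theta>)"] by simp
  have "?E ?lhs \<bullet> ?W = ?l3 \<bullet> ?l2 \<bullet> (?l1 \<bullet> ?W1) \<bullet> ?W2 \<bullet> ?W3 \<bullet> ?W4 \<bullet> ?W5"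
    by simp
  also note S1
  also have "?l3 \<bullet> ?l2 \<bullet> (?A1 \<bullet> ?A2) \<bullet> ?W2 \<bullet> ?W3 \<bullet> ?W4 \<bullet> ?W5
      = ?l3 \<bullet> ?l2 \<bullet> ?A1 \<bullet> (?A2 \<bullet> ?W2) \<bullet> ?W3 \<bullet> ?W4 \<bullet> ?W5"
    by simp
  also note S2
  also have "?l3 \<bullet> ?l2 \<bullet> ?A1 \<bullet> (?A3 \<bullet> ?A4) \<bullet> ?W3 \<bullet> ?W4 \<bullet> ?W5
      = ?l3 \<bullet> ?l2 \<bullet> ?A1 \<bullet> ?A3 \<bullet> (?A4 \<bullet> ?W3 \<bullet> ?W4 \<bullet> ?W5)"
    by simp
  also note S3
  also have "?l3 \<bullet> ?l2 \<bullet> ?A1 \<bullet> ?A3 \<bullet> (?A5 \<bullet> ?A6) = ?l3 \<bullet> ?l2 \<bullet> ?A1 \<bullet> (?A3 \<bullet> ?A5) \<bullet> ?A6"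
    by simp
  also note S4
  also have "?l3 \<bullet> ?l2 \<bullet> ?A1 \<bullet> (?A7 \<bullet> ?A8 \<bullet> ?A9) \<bullet> ?A6
      = ?l3 \<bullet> (?l2 \<bullet> ?A1 \<bullet> ?A7 \<bullet> ?A8) \<bullet> ?A9 \<bullet> ?A6"
    by simp
  also note S5
  also have "?l3 \<bullet> (?A10 \<bullet> ?A11) \<bullet> ?A9 \<bullet> ?A6 = (?l3 \<bullet> ?A10) \<bullet> ?A11 \<bullet> ?A9 \<bullet> ?A6"
    by simp
  also note S6
  also have "(?N1 \<bullet> ?A12) \<bullet> ?A11 \<bullet> ?A9 \<bullet> ?A6 = ?N1 \<bullet> (?A12 \<bullet> ?A11 \<bullet> ?A9 \<bullet> ?A6)"
    by simp
  also note S7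
  finally have lhs: "?E ?lhs \<bullet> ?W = ?N1 \<bullet> ?N2 \<bullet> ?N3" .

  let ?r1 = "?\<epsilon> a e \<rhd> (self_assoc V a b c e \<rtimes>\<^sub>2 a) \<lhd> ?mRS"
  let ?r2 = "(?\<epsilon> a e \<cdot> (?M a c e \<rtimes> a)) \<rhd> (inv2 V (\<Sigma> (?M c d e) (?M a b c)) \<rtimes>\<^sub>2 a)"
  let ?r3 = "?E (self_assoc V a c d e) \<lhd> ?PQm"
  let ?B1 = "?\<epsilon> b e \<rhd> \<Sigma> (?M b c e) (?\<epsilon> a b) \<lhd> ?mRS"
  let ?B2 = "?D b c e \<lhd> (((hm V c e \<otimes> ?R) \<ltimes> ?\<epsilon> a b) \<cdot> ?mRS)"
  let ?B3 = "(?\<epsilon> c e \<cdot> (hm V c e \<ltimes> ?\<epsilon> b c)) \<rhd> \<Sigma> (?M c d e) (?R \<ltimes> ?\<epsilon> a b)"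
  let ?B4 = "?D a c e \<lhd> ((hm V c e \<ltimes> (?M a b c \<rtimes> a)) \<cdot> ?mRS)"
  let ?B5 = "?\<epsilon> c e \<rhd> (hm V c e \<ltimes>\<^sub>2 ?D a b c) \<lhd> ?mRS"
  let ?B6 = "(?\<epsilon> c e \<cdot> (hm V c e \<ltimes> ?\<epsilon> a c)) \<rhd> (\<Sigma> (?M c d e) (?M a b c) \<rtimes>\<^sub>2 a)"
  let ?B7 = "?\<epsilon> c e \<rhd> \<Sigma> (?M c d e) (?\<epsilon> a c) \<lhd> ?PQm"
  let ?B8 = "(?\<epsilon> c e \<cdot> (?M c d e \<rtimes> c)) \<rhd> ((?P \<otimes> ?Q) \<ltimes>\<^sub>2 ?D a b c)"
  let ?B9 = "?D a c e \<lhd> ((?M c d e \<rtimes> (hm V a c \<otimes> a)) \<cdot> ?PQm)"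
  let ?B10 = "(?\<epsilon> c e \<cdot> (hm V c e \<ltimes> ?\<epsilon> a c)) \<rhd> (inv2 V (\<Sigma> (?M c d e) (?M a b c)) \<rtimes>\<^sub>2 a)"
  let ?B11 = "?D c d e \<lhd> (((?P \<otimes> ?Q) \<ltimes> ?\<epsilon> a c) \<cdot> ?PQm)"
  have T1: "?W2 \<bullet> ?W3 = ?B1 \<bullet> ?B2 \<bullet> ?B3"
    using whisker_exchange[OF _ refl refl refl refl,
        of "\<Sigma> (?M c d e) (?R \<ltimes> ?\<epsilon> a b)" "?D b c e"]
    by (simp add: interchanger_comp1_left interchanger_tensor)
  have T2: "?r1 \<bullet> ?W1 \<bullet> ?B1 \<bullet> ?B2 = ?B4 \<bullet> ?B5"
    using arg_cong[OF ev_self_assoc[of a e b c], of "\<lambda>\<theta>. \<theta> \<lhd> ?mRS"] by simp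
  \<comment> \<open>Naturality of the interchanger in \<open>d\<close> turns interchangers of
    \<open>m\<close> with evaluations into one of \<open>m\<close> with \<open>m\<close> and one
    with a single evaluation. The former, \<open>?B6\<close>, is what the inverse interchanger in
    the axiom cancels in \<open>T5\<close>.\<close>
  have T3: "?B5 \<bullet> ?B3 \<bullet> ?W4 = ?B6 \<bullet> ?B7 \<bullet> ?B8"
    using arg_cong[OF interchanger_natural_right[OF refl refl, of "?M c d e" "?D a b c"],
        of "\<lambda>\<theta>. ?\<epsilon> c e \<rhd> \<theta>"]
    by (simp add: interchanger_comp1_right interchanger_tensor)
  have T4: "?r2 \<bullet> ?B4 = ?B9 \<bullet> ?B10"
    using whisker_exchange[OF _ refl refl refl refl,
        of "inv2 V (\<Sigma> (?M c d e) (?M a b c)) \<rtimes>\<^sub>2 a" "?D a c e"] by simp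
  have T5: "?B10 \<bullet> ?B6 \<bullet> ?B7 = ?B7"
    by (simp add: inv2_rtensor2[symmetric] inv2_whisker_left[symmetric])
  have T6: "?B8 \<bullet> ?W5 = ?B11 \<bullet> ?N3"
    using whisker_exchange[OF _ refl refl refl refl,
        of "(?P \<otimes> ?Q) \<ltimes>\<^sub>2 ?D a b c" "?D c d e"] by simp
  have T7: "?r3 \<bullet> ?B9 \<bullet> ?B7 \<bullet> ?B11 = ?N1 \<bullet> ?N2"
    using arg_cong[OF ev_self_assoc[of a e c d], of "\<lambda>\<theta>. \<theta> \<lhd> ?PQm"] by simp
  have "?E ?rhs \<bullet> ?W = ?r3 \<bullet> ?r2 \<bullet> ?r1 \<bullet> ?W1 \<bullet> (?W2 \<bullet> ?W3) \<bullet> ?W4 \<bullet> ?W5"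
    by simp
  also note T1
  also have "?r3 \<bullet> ?r2 \<bullet> ?r1 \<bullet> ?W1 \<bullet> (?B1 \<bullet> ?B2 \<bullet> ?B3) \<bullet> ?W4 \<bullet> ?W5
      = ?r3 \<bullet> ?r2 \<bullet> (?r1 \<bullet> ?W1 \<bullet> ?B1 \<bullet> ?B2) \<bullet> ?B3 \<bullet> ?W4 \<bullet> ?W5"
    by simp
  also note T2
  also have "?r3 \<bullet> ?r2 \<bullet> (?B4 \<bullet> ?B5) \<bullet> ?B3 \<bullet> ?W4 \<bullet> ?W5
      = ?r3 \<bullet> (?r2 \<bullet> ?B4) \<bullet> (?B5 \<bullet> ?B3 \<bullet> ?W4) \<bullet> ?W5"
    by simp
  also note T3
  also note T4
  also have "?r3 \<bullet> (?B9 \<bullet> ?B10) \<bullet> (?B6 \<bullet> ?B7 \<bullet> ?B8) \<bullet> ?W5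
      = ?r3 \<bullet> ?B9 \<bullet> (?B10 \<bullet> ?B6 \<bullet> ?B7) \<bullet> (?B8 \<bullet> ?W5)"
    by simp
  also note T5
  also note T6
  also have "?r3 \<bullet> ?B9 \<bullet> ?B7 \<bullet> (?B11 \<bullet> ?N3) = (?r3 \<bullet> ?B9 \<bullet> ?B7 \<bullet> ?B11) \<bullet> ?N3"
    by simp
  also note T7
  also have "(?N1 \<bullet> ?N2) \<bullet> ?N3 = ?N1 \<bullet> ?N2 \<bullet> ?N3"
    by simp
  finally have rhs: "?E ?rhs \<bullet> ?W = ?N1 \<bullet> ?N2 \<bullet> ?N3" .
  have "?E ?lhs = ?E ?rhs"
    by (rule vcomp_right_cancel[OF trans[OF lhs rhs[symmetric]]]) simp_all
  then show ?thesis
    by (rule ev_faithful) simp_all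
qed

end

theorem theorem4p24:
  fixes V :: "('o, 'a, 't) closed_gray"
  assumes "right_closed_gray_monoid V"
  shows "enriched_bicategory V (self_enrichment V)"
proof -
  interpret right_closed_gray_monoid V
    by (rule assms)
  show ?thesis
    by unfold_locales
      (simp_all add: self_enrichment_def hom1_def hom2_def iso2_def self_enrichment_IC
        self_enrichment_AC)
qed

end
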